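(* Let $g:\mathbb R\to(0,\infty)$ be a differentiable probability density function with $\sup_{x\in\mathbb R}g(x)<\infty$, and suppose there is a constant $M$ such that for all $x_1,y_1\in\mathbb R$, \[ \left|-\frac{\mathrm d\log g(x_1)}{\mathrm dx_1}+\frac{\mathrm d\log g(y_1)}{\mathrm dy_1}\right|\le M|x_1-y_1| . \] For each positive integer $n$ let $\pi_n(x)=\prod_{i=1}^ng(x_i)$, $x=(x_1,\dots,x_n)\in\mathbb R^n$, and let $P_n$ be the transition kernel of the Metropolis adjusted Langevin algorithm on $\mathbb R^n$ with target density $\pi_n$ and step size $h_n>0$. Suppose that for some $\gamma>0$, $h_n<n^{-\gamma}$ for all $n$. Then, for any $\gamma'>0$, \[ \lim_{n\to\infty}n^{\gamma'}\,[1-\rho^\dagger_{\mathrm{opt}}(P_n)]=0 . \]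
   Context: Metropolis adjusted Langevin algorithm (MALA): let $f_n=-\log\pi_n$ on $\mathbb R^n$, let $\Pi_n$ be the probability measure with density $\pi_n$, and let \[ a_n(x,y)=\min\left\{1,\frac{\pi_n(y)\exp[-\|x-y+h_n\nabla f_n(y)\|^2/(4h_n)]}{\pi_n(x)\exp[-\|y-x+h_n\nabla f_n(x)\|^2/(4h_n)]}\right\}. \] The MALA kernel with step size $h_n$ is \[ P_n(x,A)=\int_{\mathbb R^n}(4\pi h_n)^{-n/2}\exp\Big(-\tfrac1{4h_n}\|y-x+h_n\nabla f_n(x)\|^2\Big)\{a_n(x,y)1_A(y)+[1-a_n(x,y)]1_A(x)\}\,\mathrm dy \] (where $\pi$ in $(4\pi h_n)^{-n/2}$ is the numerical constant). It is reversible with respect to $\Pi_n$. An Mtk (Markov transition kernel) is a Markov transition kernel $P:\mathsf X\times\mathcal B\to[0,1]$ on a countably generated measurable space $(\mathsf X,\mathcal B)$ (Borel $\sigma$-algebra for $\mathbb R^n$). Write $Pf(x)=\int_{\mathsf X}P(x,\mathrm dy)f(y)$, $P^m$ for the $m$-step kernel, and $\delta_xP^m=P^m(x,\cdot)$. Total variation distance: $d_{\mathrm{TV}}(\mu,\nu)=\sup_{A\in\mathcal B}[\mu(A)-\nu(A)]$. If $P$ has stationary probability measure $\Pi$, its convergence rate is \[ \rho_*(P)=\exp\Big[\sup_{x\in\mathsf X}\limsup_{m\to\infty}\frac{\log d_{\mathrm{TV}}(\delta_xP^m,\Pi)}{m}\Big]\in[0,1] \] (with $\log 0=-\infty$, $\exp(-\infty)=0$).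 Let $\tilde T_0=[0,1)\times[0,\infty)\times(0,1]\times[0,\infty)$. $P$ satisfies (B1)-(B3) with parameter $(\eta,L,\varepsilon,d)\in\tilde T_0$ if there are a measurable $V:\mathsf X\to[0,\infty)$ and a probability measure $\nu$ on $\mathcal B$ such that: (B1) $PV(x)\le\eta V(x)+L$ for all $x\in\mathsf X$; (B2) $d>0$ and $P(x,A)\ge\varepsilon\nu(A)$ for all $x\in C$, $A\in\mathcal B$, where $C=\{x\in\mathsf X:V(x)\le d\}$; (B3) $d>2L/(1-\eta)$. It is known that (B1)-(B3) imply that $P$ has a unique stationary distribution $\Pi$. Let $\tilde T(P)\subset\tilde T_0$ be the set of all parameters with which $P$ satisfies (B1)-(B3). Let $S_{\eta,L,\varepsilon,d}$ be the collection of all Mtks (on varying state spaces) satisfying (B1)-(B3) with parameter $(\eta,L,\varepsilon,d)$. (For set-theoretic reasons, the state spaces are taken from some fixed set of measurable spaces, which includes at least all finite sets of integers.) Define $\rho_{\mathrm{opt}}(\eta,L,\varepsilon,d)=\sup_{Q\in S_{\eta,L,\varepsilon,d}}\rho_*(Q)$ (equal to $0$ if $S_{\eta,L,\varepsilon,d}=\emptyset$), and \[ \rho^\dagger_{\mathrm{opt}}(P)=\inf_{(\eta,L,\varepsilon,d)\in\tilde T(P)}\rho_{\mathrm{opt}}(\eta,L,\varepsilon,d), \] set equal to $1$ if $\tilde T(P)=\emptyset$. *)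

theory Defs
  imports "HOL-Probability.Probability"
begin

definition countably_generated :: "'a measure \<Rightarrow> bool" where
  "countably_generated X \<longleftrightarrow>
     (\<exists>G. countable G \<and> G \<subseteq> Pow (space X) \<and> sets X = sigma_sets (space X) G)"

text \<open>A \<^typ>\<open>'a measure\<close> \<open>X\<close> serves below only as the measurable space
  \<open>(space X, sets X)\<close>; the measure it carries is never used. The kernel
  \<open>P(x, A)\<close> is \<open>measure (P x) A\<close>.\<close>

definition Mtk :: "'a measure \<Rightarrow> ('a \<Rightarrow> 'a measure) \<Rightarrow> bool" where
  "Mtk X P \<longleftrightarrow> countably_generated X \<and> P \<in> X \<rightarrow>\<^sub>M prob_algebra X"

primrec kernel_power :: "'a measure \<Rightarrow> ('a \<Rightarrow> 'a measure) \<Rightarrow> nat \<Rightarrow> 'a \<Rightarrow> 'a measure" where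
  "kernel_power X P 0 x = return X x"
| "kernel_power X P (Suc m) x = kernel_power X P m x \<bind> P"

definition stationary :: "'a measure \<Rightarrow> ('a \<Rightarrow> 'a measure) \<Rightarrow> 'a measure \<Rightarrow> bool" where
  "stationary X P \<mu> \<longleftrightarrow> \<mu> \<in> space (prob_algebra X) \<and> \<mu> \<bind> P = \<mu>"

definition d_TV :: "'a measure \<Rightarrow> 'a measure \<Rightarrow> real" where
  "d_TV \<mu> \<nu> = (SUP A\<in>sets \<mu>. measure \<mu> A - measure \<nu> A)"

definition ln_ereal :: "real \<Rightarrow> ereal" where
  "ln_ereal t = (if t \<le> 0 then -\<infinity> else ereal (ln t))"

definition exp_ereal :: "ereal \<Rightarrow> ereal" where
  "exp_ereal e = (case e of ereal r \<Rightarrow> ereal (exp r) | PInfty \<Rightarrow> \<infinity> | MInfty \<Rightarrow> 0)"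

text \<open>The stationary distribution \<open>\<mu>\<close> is an explicit argument. Since total variation distance
  is at most 1, the exponent lies in \<open>[-\<infinity>, 0]\<close> and \<^const>\<open>real_of_ereal\<close> loses nothing.\<close>

definition rho_star :: "'a measure \<Rightarrow> ('a \<Rightarrow> 'a measure) \<Rightarrow> 'a measure \<Rightarrow> real" where
  "rho_star X P \<mu> = real_of_ereal (exp_ereal
     (SUP x\<in>space X. limsup (\<lambda>m. ln_ereal (d_TV (kernel_power X P m x) \<mu>) / ereal (real m))))"

type_synonym dm_param = "real \<times> real \<times> real \<times> real"

definition T0 :: "dm_param set" where
  "T0 = {0..<1} \<times> {0..} \<times> {0<..1} \<times> {0..}"

definition drift_minor :: "'a measure \<Rightarrow> ('a \<Rightarrow> 'a measure) \<Rightarrow> dm_param \<Rightarrow> bool" where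
  "drift_minor X P = (\<lambda>(\<eta>, L, \<epsilon>, d). \<exists>V \<nu>.
      V \<in> borel_measurable X \<and> (\<forall>x\<in>space X. 0 \<le> V x) \<and> \<nu> \<in> space (prob_algebra X) \<and>
      (\<forall>x\<in>space X. (\<integral>\<^sup>+y. ennreal (V y) \<partial>P x) \<le> ennreal (\<eta> * V x + L)) \<and>
      d > 0 \<and>
      (\<forall>x\<in>{x \<in> space X. V x \<le> d}. \<forall>A\<in>sets X. measure (P x) A \<ge> \<epsilon> * measure \<nu> A) \<and>
      d > 2 * L / (1 - \<eta>))"

definition T_tilde :: "'a measure \<Rightarrow> ('a \<Rightarrow> 'a measure) \<Rightarrow> dm_param set" where
  "T_tilde X P = {\<theta> \<in> T0. drift_minor X P \<theta>}"

text \<open>\<open>\<SS>\<close> is the fixed set of admissible state spaces. The pairs \<open>(Q, \<mu>)\<close> below amount to the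
  kernels \<open>Q\<close> alone, because the drift and minorization conditions make the stationary
  distribution of \<open>Q\<close> exist and be unique. The case distinctions in \<open>rho_opt\<close> and \<open>rho_dagger\<close>
  are needed because \<open>Sup {}\<close> and \<open>Inf {}\<close> are unspecified on the reals.\<close>

definition rates :: "'u measure set \<Rightarrow> dm_param \<Rightarrow> real set" where
  "rates \<SS> \<theta> = {rho_star X Q \<mu> | X Q \<mu>.
     X \<in> \<SS> \<and> Mtk X Q \<and> drift_minor X Q \<theta> \<and> stationary X Q \<mu>}"

definition rho_opt :: "'u measure set \<Rightarrow> dm_param \<Rightarrow> real" where
  "rho_opt \<SS> \<theta> = (if rates \<SS> \<theta> = {} then 0 else Sup (rates \<SS> \<theta>))"

definition rho_dagger :: "'u measure set \<Rightarrow> 'a measure \<Rightarrow> ('a \<Rightarrow> 'a measure) \<Rightarrow> real" where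
  "rho_dagger \<SS> X P =
     (if T_tilde X P = {} then 1 else (INF \<theta>\<in>T_tilde X P. rho_opt \<SS> \<theta>))"

text \<open>Vectors in \<open>\<real>\<^sup>n\<close> are functions \<^typ>\<open>nat \<Rightarrow> real\<close> that are \<^const>\<open>undefined\<close> outside
  \<open>{..<n}\<close>. The product \<open>\<sigma>\<close>-algebra of finitely many copies of \<open>borel\<close> is the Borel
  \<open>\<sigma>\<close>-algebra, and the product of the copies of \<open>lborel\<close> is \<open>n\<close>-dimensional Lebesgue measure.\<close>

abbreviation Rn :: "nat \<Rightarrow> (nat \<Rightarrow> real) measure" where
  "Rn n \<equiv> Pi\<^sub>M {..<n} (\<lambda>_. borel)"

abbreviation lborel_Rn :: "nat \<Rightarrow> (nat \<Rightarrow> real) measure" where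
  "lborel_Rn n \<equiv> Pi\<^sub>M {..<n} (\<lambda>_. lborel)"

definition gradient :: "((nat \<Rightarrow> real) \<Rightarrow> real) \<Rightarrow> (nat \<Rightarrow> real) \<Rightarrow> nat \<Rightarrow> real" where
  "gradient f x i = deriv (\<lambda>t. f (x(i := t))) (x i)"

text \<open>Unnormalised proposal density
  \<open>exp (- \<parallel>y - x + h \<nabla>f(x)\<parallel>\<^sup>2 / (4h))\<close> with \<open>f = - log p\<close>.\<close>

definition mala_weight ::
  "nat \<Rightarrow> ((nat \<Rightarrow> real) \<Rightarrow> real) \<Rightarrow> real \<Rightarrow> (nat \<Rightarrow> real) \<Rightarrow> (nat \<Rightarrow> real) \<Rightarrow> real" where
  "mala_weight n p h x y =
     exp (- (L2_set (\<lambda>i. y i - x i + h * gradient (\<lambda>z. - ln (p z)) x i) {..<n})\<^sup>2 / (4 * h))"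

definition mala_accept ::
  "nat \<Rightarrow> ((nat \<Rightarrow> real) \<Rightarrow> real) \<Rightarrow> real \<Rightarrow> (nat \<Rightarrow> real) \<Rightarrow> (nat \<Rightarrow> real) \<Rightarrow> real" where
  "mala_accept n p h x y =
     min 1 ((p y * mala_weight n p h y x) / (p x * mala_weight n p h x y))"

definition mala_kernel ::
  "nat \<Rightarrow> ((nat \<Rightarrow> real) \<Rightarrow> real) \<Rightarrow> real \<Rightarrow> (nat \<Rightarrow> real) \<Rightarrow> (nat \<Rightarrow> real) measure" where
  "mala_kernel n p h x = measure_of (space (Rn n)) (sets (Rn n))
     (\<lambda>A. \<integral>\<^sup>+y. ennreal ((4 * pi * h) powr (- real n / 2) * mala_weight n p h x y *
              (mala_accept n p h x y * indicator A y
               + (1 - mala_accept n p h x y) * indicator A x)) \<partial>lborel_Rn n)"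

end

theory Submission
  imports Defs "HOL-Real_Asymp.Real_Asymp"
begin

text \<open>
  A rate bound computed from the parameters \<open>(\<eta>, L, \<epsilon>, d)\<close> alone has to cover every chain with these
  parameters. One of them is the two-state chain that resamples from its stationary law with
  probability \<open>\<epsilon>\<close> and otherwise stays where it is; it converges at rate \<open>1 - \<epsilon>\<close>. Hence
  \<open>\<rho>\<^sub>o\<^sub>p\<^sub>t \<ge> 1 - \<epsilon>\<close> (\<open>rho_opt_ge_one_minus_eps\<close>), and it suffices to show that every drift and minorization
  pair for the Langevin kernel has a minorization constant \<open>\<epsilon>\<close> that decays faster than any power
  of \<open>n\<close>.

  The drift condition together with \<open>d > 2L / (1 - \<eta>)\<close> forces the small set \<open>C = {V \<le> d}\<close> to have
  stationary mass above \<open>1/2\<close> (\<open>drift_small_set_mass\<close>); for this the stationarity of the target under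
  the Metropolis--Hastings kernel is needed (\<open>mh_stationary\<close>). The first coordinate of the target has
  the bounded density \<open>g\<close>, so a set of mass above \<open>1/2\<close> cannot be thin in that coordinate: it contains
  two points whose first coordinates differ by a constant that does not depend on \<open>n\<close>
  (\<open>small_set_spread\<close>). The score is Lipschitz, so for small \<open>h\<close> the Gaussian proposals from these
  points have well separated means in the first coordinate, with variance only \<open>2h\<close>. Their overlap,
  and with it \<open>\<epsilon>\<close>, is at most of order \<open>exp (- c / h)\<close> (\<open>mala_minorization_tiny\<close>). With \<open>h < n\<^sup>-\<^sup>\<gamma>\<close> this
  is at most of order \<open>exp (- c n\<^sup>\<gamma>)\<close>, which beats every power of \<open>n\<close>.
\<close>

section \<open>Bounds on convergence rates\<close>

lemma kernel_power_prob:
  assumes "Mtk X P" "x \<in> space X"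
  shows "kernel_power X P m x \<in> space (prob_algebra X)"
proof (induction m)
  case 0
  then show ?case using assms(2) by (auto simp: space_prob_algebra intro: prob_space_return)
next
  case (Suc m)
  have "P \<in> X \<rightarrow>\<^sub>M prob_algebra X" using assms(1) by (simp add: Mtk_def)
  with Suc show ?case
    by (simp add: space_prob_algebra prob_space_bind'[of _ X P X] sets_bind'[of _ X P X])
qed

lemma prob_measure_le_1:
  assumes "\<mu> \<in> space (prob_algebra X)" shows "measure \<mu> A \<le> 1"
proof -
  interpret prob_space \<mu> using assms by (simp add: space_prob_algebra)
  show ?thesis by simp
qed

lemma d_TV_le_1:
  assumes "\<mu> \<in> space (prob_algebra X)"
  shows "d_TV \<mu> \<nu> \<le> 1"
  unfolding d_TV_def
proof (rule cSUP_least)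
  fix A assume "A \<in> sets \<mu>"
  show "measure \<mu> A - measure \<nu> A \<le> 1"
    using prob_measure_le_1[OF assms, of A] measure_nonneg[of \<nu> A] by linarith
qed (use sets.empty_sets in blast)

lemma exp_ereal_mono: "a \<le> b \<Longrightarrow> exp_ereal a \<le> exp_ereal b"
  by (cases a; cases b) (auto simp: exp_ereal_def)

lemma exp_ereal_nonneg: "0 \<le> exp_ereal a"
  by (cases a) (auto simp: exp_ereal_def)

lemma rho_exponent_nonpos:
  assumes "Mtk X Q"
  shows "(SUP x\<in>space X. limsup (\<lambda>m. ln_ereal (d_TV (kernel_power X Q m x) \<mu>) / ereal (real m))) \<le> 0"
proof (intro SUP_least Limsup_bounded eventually_sequentiallyI[of 1])
  fix x m assume x: "x \<in> space X" and m: "1 \<le> (m::nat)"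
  have "ln_ereal (d_TV (kernel_power X Q m x) \<mu>) \<le> 0"
    using d_TV_le_1[OF kernel_power_prob[OF assms x], of m \<mu>] by (auto simp: ln_ereal_def)
  then show "ln_ereal (d_TV (kernel_power X Q m x) \<mu>) / ereal (real m) \<le> 0"
    using m by (cases "ln_ereal (d_TV (kernel_power X Q m x) \<mu>)") (auto simp: divide_nonpos_pos)
qed

lemma rho_star_bounds:
  assumes "Mtk X Q"
  shows "0 \<le> rho_star X Q \<mu>" "rho_star X Q \<mu> \<le> 1"
proof -
  have "exp_ereal (SUP x\<in>space X. limsup (\<lambda>m. ln_ereal (d_TV (kernel_power X Q m x) \<mu>) / ereal (real m))) \<le> exp_ereal 0"
    by (rule exp_ereal_mono[OF rho_exponent_nonpos[OF assms]])
  also have "\<dots> = 1" by (simp add: exp_ereal_def zero_ereal_def)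
  finally show "rho_star X Q \<mu> \<le> 1"
    unfolding rho_star_def by (auto intro: real_of_ereal_le_1)
  show "0 \<le> rho_star X Q \<mu>"
    unfolding rho_star_def by (intro real_of_ereal_pos exp_ereal_nonneg)
qed

text \<open>A single starting point from which the distance decays like \<open>r\<^sup>m\<close> already forces the rate
  up to \<open>r\<close>. Positivity of the distances keeps the extended logarithm in its real branch.\<close>

lemma rho_star_ge:
  assumes "Mtk X Q" "x \<in> space X"
    and lim: "(\<lambda>m. ln (d_TV (kernel_power X Q m x) \<mu>) / real m) \<longlonglongrightarrow> ln r"
    and pos: "\<And>m. d_TV (kernel_power X Q m x) \<mu> > 0" and r: "r > 0"
  shows "r \<le> rho_star X Q \<mu>"
proof -
  let ?E = "SUP x\<in>space X. limsup (\<lambda>m. ln_ereal (d_TV (kernel_power X Q m x) \<mu>) / ereal (real m))"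
  have "(\<lambda>m. ereal (ln (d_TV (kernel_power X Q m x) \<mu>) / real m)) \<longlonglongrightarrow> ereal (ln r)"
    using lim by (simp add: lim_ereal)
  moreover have "\<forall>\<^sub>F m in sequentially. ln_ereal (d_TV (kernel_power X Q m x) \<mu>) / ereal (real m)
     = ereal (ln (d_TV (kernel_power X Q m x) \<mu>) / real m)"
    using pos by (intro eventually_sequentiallyI[of 1]) (auto simp: ln_ereal_def not_le[symmetric])
  ultimately have "(\<lambda>m. ln_ereal (d_TV (kernel_power X Q m x) \<mu>) / ereal (real m)) \<longlonglongrightarrow> ereal (ln r)"
    by (simp add: filterlim_cong)
  from lim_imp_Limsup[OF sequentially_bot this]
  have "ereal (ln r) \<le> ?E" using assms(2) by (intro SUP_upper2[of x]) auto
  moreover have "?E \<le> 0" by (rule rho_exponent_nonpos[OF assms(1)])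
  ultimately obtain e where e: "?E = ereal e" "ln r \<le> e"
    by (cases ?E) auto
  then have "r \<le> exp e" using r by (metis exp_le_cancel_iff exp_ln)
  then show ?thesis unfolding rho_star_def e by (simp add: exp_ereal_def)
qed

lemma rates_le_1: "r \<in> rates \<SS> \<theta> \<Longrightarrow> r \<le> 1"
  by (auto simp: rates_def intro: rho_star_bounds)

lemma rho_opt_le_1: "rho_opt \<SS> \<theta> \<le> 1"
  unfolding rho_opt_def using cSup_least[of "rates \<SS> \<theta>" 1] rates_le_1[of _ \<SS> \<theta>] by simp

lemma rho_opt_ge: "r \<in> rates \<SS> \<theta> \<Longrightarrow> r \<le> rho_opt \<SS> \<theta>"
proof -
  assume r: "r \<in> rates \<SS> \<theta>"
  have "bdd_above (rates \<SS> \<theta>)" by (rule bdd_aboveI[of _ 1]) (rule rates_le_1)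
  with r show ?thesis unfolding rho_opt_def by (auto intro: cSup_upper)
qed

section \<open>A lazy two-state chain attaining the rate \<open>1 - \<epsilon>\<close>\<close>

text \<open>The law \<open>p \<delta>\<^sub>a + (1 - p) \<delta>\<^sub>b\<close>. As the image of a coin flip it is a probability measure on the
  \<open>\<sigma>\<close>-algebra of \<open>X\<close>, whatever measure \<open>X\<close> happens to carry.\<close>

definition two_point :: "'u measure \<Rightarrow> 'u \<Rightarrow> 'u \<Rightarrow> real \<Rightarrow> 'u measure" where
  "two_point X a b p = distr (measure_pmf (bernoulli_pmf p)) X (\<lambda>c. if c then a else b)"

lemma two_point_measurable:
  "a \<in> space X \<Longrightarrow> b \<in> space X \<Longrightarrow> (\<lambda>c. if c then a else b) \<in> measure_pmf q \<rightarrow>\<^sub>M X"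
  by simp

lemma sets_two_point [simp]: "sets (two_point X a b p) = sets X"
  by (simp add: two_point_def)

lemma two_point_prob:
  assumes "a \<in> space X" "b \<in> space X"
  shows "two_point X a b p \<in> space (prob_algebra X)"
  using two_point_measurable[OF assms] unfolding two_point_def
  by (auto simp: space_prob_algebra intro!: measure_pmf.prob_space_distr)

lemma nn_integral_two_point:
  assumes "a \<in> space X" "b \<in> space X" "f \<in> borel_measurable X" "p \<in> {0..1}"
  shows "(\<integral>\<^sup>+z. f z \<partial>two_point X a b p) = ennreal p * f a + ennreal (1 - p) * f b"
  using assms unfolding two_point_def
  by (subst nn_integral_distr) (auto simp: mult.commute)

lemma emeasure_two_point:
  assumes "a \<in> space X" "b \<in> space X" "A \<in> sets X" "p \<in> {0..1}"
  shows "emeasure (two_point X a b p) A = ennreal (p * indicator A a + (1 - p) * indicator A b)"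
  using nn_integral_two_point[OF assms(1,2) _ assms(4), of "indicator A"] assms(3,4)
  by (simp add: nn_integral_indicator) (auto simp: indicator_def simp flip: ennreal_plus)

lemma measure_two_point:
  assumes "a \<in> space X" "b \<in> space X" "A \<in> sets X" "p \<in> {0..1}"
  shows "measure (two_point X a b p) A = p * indicator A a + (1 - p) * indicator A b"
  using emeasure_two_point[OF assms] assms(4) by (intro measure_eq_emeasure_eq_ennreal) auto

text \<open>The chain that stays put with probability \<open>1 - \<epsilon>\<close> and otherwise resamples from the fair coin on
  \<open>{a, b}\<close>; leaving the current state thus has probability \<open>\<epsilon>/2\<close>.\<close>

definition lazy_coin :: "'u measure \<Rightarrow> 'u \<Rightarrow> 'u \<Rightarrow> real \<Rightarrow> 'u \<Rightarrow> 'u measure" where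
  "lazy_coin X a b \<epsilon> x = two_point X a b (if x = a then 1 - \<epsilon>/2 else \<epsilon>/2)"

lemma lazy_coin_measurable:
  assumes "a \<in> space X" "b \<in> space X" "sets X = sets (count_space {a, b})"
  shows "lazy_coin X a b \<epsilon> \<in> X \<rightarrow>\<^sub>M prob_algebra X"
  using two_point_prob[OF assms(1,2)]
  by (simp add: lazy_coin_def measurable_cong_sets[OF assms(3) refl])

lemma two_point_bind_lazy_coin:
  assumes X: "a \<in> space X" "b \<in> space X" "sets X = sets (count_space {a, b})" and ab: "a \<noteq> b"
    and p: "p \<in> {0..1}" and e: "\<epsilon> \<in> {0..1}"
  shows "two_point X a b p \<bind> lazy_coin X a b \<epsilon> = two_point X a b (\<epsilon>/2 + (1 - \<epsilon>) * p)"
proof (rule measure_eqI)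
  have K: "lazy_coin X a b \<epsilon> \<in> two_point X a b p \<rightarrow>\<^sub>M prob_algebra X"
    using lazy_coin_measurable[OF X] by (simp add: measurable_cong_sets[of "two_point X a b p" X])
  have K': "lazy_coin X a b \<epsilon> \<in> two_point X a b p \<rightarrow>\<^sub>M subprob_algebra X"
    by (rule measurable_prob_algebraD[OF K])
  have ne: "space (two_point X a b p) \<noteq> {}"
    using X by (metis empty_iff sets_eq_imp_space_eq sets_two_point)
  show "sets (two_point X a b p \<bind> lazy_coin X a b \<epsilon>) = sets (two_point X a b (\<epsilon>/2 + (1 - \<epsilon>) * p))"
    using sets_bind[OF _ ne, of "lazy_coin X a b \<epsilon>" X] by (simp add: lazy_coin_def)
  fix A assume "A \<in> sets (two_point X a b p \<bind> lazy_coin X a b \<epsilon>)"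
  then have A: "A \<in> sets X"
    using sets_bind[OF _ ne, of "lazy_coin X a b \<epsilon>" X] by (simp add: lazy_coin_def)
  have p': "1 - \<epsilon>/2 \<in> {0..1}" "\<epsilon>/2 \<in> {0..1}" using e by auto
  have "\<epsilon>/2 + (1 - \<epsilon>) * p \<le> \<epsilon>/2 + (1 - \<epsilon>) * 1"
    using p e by (intro add_left_mono mult_left_mono) auto
  then have pp: "\<epsilon>/2 + (1 - \<epsilon>) * p \<in> {0..1}" using p e by auto
  have m: "(\<lambda>x. emeasure (lazy_coin X a b \<epsilon> x) A) \<in> borel_measurable X"
    by (simp add: measurable_cong_sets[OF X(3) refl])
  have "emeasure (two_point X a b p \<bind> lazy_coin X a b \<epsilon>) A
     = (\<integral>\<^sup>+x. emeasure (lazy_coin X a b \<epsilon> x) A \<partial>two_point X a b p)"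
    by (rule emeasure_bind[OF ne K' A])
  also have "\<dots> = ennreal p * emeasure (lazy_coin X a b \<epsilon> a) A
      + ennreal (1 - p) * emeasure (lazy_coin X a b \<epsilon> b) A"
    by (rule nn_integral_two_point[OF X(1,2) m p])
  also have "\<dots> = emeasure (two_point X a b (\<epsilon>/2 + (1 - \<epsilon>) * p)) A"
  proof -
    have comb: "ennreal p * ennreal u + ennreal (1 - p) * ennreal v = ennreal w"
      if "0 \<le> u" "0 \<le> v" "w = p * u + (1 - p) * v" for u v w
      using p that by (simp add: ennreal_mult)
    have "emeasure (lazy_coin X a b \<epsilon> a) A = ennreal ((1 - \<epsilon>/2) * indicator A a + \<epsilon>/2 * indicator A b)"
      using emeasure_two_point[OF X(1,2) A p'(1)] by (simp add: lazy_coin_def)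
    moreover have "emeasure (lazy_coin X a b \<epsilon> b) A
        = ennreal (\<epsilon>/2 * indicator A a + (1 - \<epsilon>/2) * indicator A b)"
      using emeasure_two_point[OF X(1,2) A p'(2)] ab by (simp add: lazy_coin_def)
    ultimately show ?thesis
      unfolding emeasure_two_point[OF X(1,2) A pp] using p'
      by (simp only:) (rule comb, auto simp: indicator_def field_simps)
  qed
  finally show "emeasure (two_point X a b p \<bind> lazy_coin X a b \<epsilon>) A
      = emeasure (two_point X a b (\<epsilon>/2 + (1 - \<epsilon>) * p)) A" .
qed

lemma kernel_power_lazy_coin:
  assumes X: "a \<in> space X" "b \<in> space X" "sets X = sets (count_space {a, b})" and ab: "a \<noteq> b"
    and e: "\<epsilon> \<in> {0..1}"
  shows "kernel_power X (lazy_coin X a b \<epsilon>) m a = two_point X a b (1/2 + (1 - \<epsilon>)^m / 2)"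
proof (induction m)
  case 0
  show ?case
    by (rule measure_eqI) (auto simp: emeasure_two_point[OF X(1,2)] indicator_def)
next
  case (Suc m)
  have "(1 - \<epsilon>)^m \<in> {0..1}" using e by (auto intro: power_le_one)
  then have "1/2 + (1 - \<epsilon>)^m / 2 \<in> {0..1}" by auto
  from two_point_bind_lazy_coin[OF X ab this e] Suc
  show ?case by (simp add: field_simps)
qed

text \<open>With \<open>V = 0\<close> the drift inequality is trivial for all admissible \<open>\<eta>\<close>, \<open>L\<close>, \<open>d\<close>, and the small
  set is the whole space. The only constraint left is the minorization, which the lazy chain satisfies
  with exactly the given \<open>\<epsilon>\<close>. Its distance to stationarity is \<open>(1 - \<epsilon>)\<^sup>m / 2\<close>, so no bound that depends
  on the parameters alone can beat \<open>1 - \<epsilon>\<close>.\<close>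

lemma rho_opt_ge_one_minus_eps:
  fixes \<SS> :: "'u measure set" and \<iota> :: "int \<Rightarrow> 'u"
  assumes "inj \<iota>"
    and SS: "\<And>F. finite F \<Longrightarrow> \<exists>X\<in>\<SS>. sets X = sets (count_space (\<iota> ` F))"
    and T: "\<eta> \<in> {0..<1}" "L \<ge> 0" "\<epsilon> \<in> {0<..1}" "d > 0" "d > 2 * L / (1 - \<eta>)"
  shows "1 - \<epsilon> \<le> rho_opt \<SS> (\<eta>, L, \<epsilon>, d)"
proof -
  define a where "a = \<iota> (0::int)"
  define b where "b = \<iota> (1::int)"
  have ab: "a \<noteq> b" by (simp add: a_def b_def inj_eq[OF assms(1)])
  obtain X where XS: "X \<in> \<SS>" and sX: "sets X = sets (count_space {a, b})"
    using SS[of "{0,1}"] by (auto simp: a_def b_def)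
  have spX: "space X = {a, b}" using sets_eq_imp_space_eq[OF sX] by simp
  have X: "a \<in> space X" "b \<in> space X" by (auto simp: spX)
  define Q where "Q = lazy_coin X a b \<epsilon>"
  define \<mu> where "\<mu> = two_point X a b (1/2)"
  have e: "\<epsilon> \<in> {0..1}" using T by auto
  have "countably_generated X"
    unfolding countably_generated_def
    by (intro exI[of _ "sets X"] conjI sets.space_closed)
      (simp_all add: sets.sigma_sets_eq, simp add: sX countable_finite)
  then have Mtk: "Mtk X Q"
    using lazy_coin_measurable[OF X sX] by (simp add: Mtk_def Q_def)
  have stat: "stationary X Q \<mu>"
    using two_point_prob[OF X] two_point_bind_lazy_coin[OF X sX ab _ e, of "1/2"]
    unfolding stationary_def Q_def \<mu>_def by (simp add: field_simps)
  have minor: "\<epsilon> * measure \<mu> A \<le> measure (Q x) A" if "A \<in> sets X" for x A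
    using that e unfolding \<mu>_def Q_def lazy_coin_def
    by (auto simp: measure_two_point[OF X] indicator_def)
  have drift: "drift_minor X Q (\<eta>, L, \<epsilon>, d)"
    unfolding drift_minor_def prod.case
    by (rule exI[of _ "\<lambda>_. 0"], rule exI[of _ \<mu>])
      (use T minor two_point_prob[OF X] in \<open>auto simp: \<mu>_def\<close>)
  have in_rates: "rho_star X Q \<mu> \<in> rates \<SS> (\<eta>, L, \<epsilon>, d)"
    unfolding rates_def using XS Mtk drift stat by blast
  have "1 - \<epsilon> \<le> rho_star X Q \<mu>"
  \<comment> \<open>For \<open>\<epsilon> = 1\<close> the distance vanishes after one step and its logarithm is \<open>-\<infinity>\<close>.\<close>
  proof (cases "\<epsilon> = 1")
    case True
    then show ?thesis using rho_star_bounds(1)[OF Mtk] by simp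
  next
    case False
    then have r: "1 - \<epsilon> > 0" using T by auto
    have TV: "d_TV (kernel_power X Q m a) \<mu> = (1 - \<epsilon>)^m / 2" for m
    proof -
      have "(1 - \<epsilon>)^m \<in> {0..1}" using e by (auto intro: power_le_one)
      then have p: "1/2 + (1 - \<epsilon>)^m / 2 \<in> {0..1}" "0 \<le> (1 - \<epsilon>)^m" by auto
      have *: "measure (kernel_power X Q m a) A - measure \<mu> A
           = (1 - \<epsilon>)^m / 2 * (indicator A a - indicator A b)" if "A \<in> sets X" for A
        using that p unfolding Q_def kernel_power_lazy_coin[OF X sX ab e] \<mu>_def
        by (simp add: measure_two_point[OF X] field_simps)
      have sK: "sets (kernel_power X Q m a) = sets X"
        unfolding Q_def kernel_power_lazy_coin[OF X sX ab e] by simp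
      have "d_TV (kernel_power X Q m a) \<mu>
          = (SUP A\<in>sets X. (1 - \<epsilon>)^m / 2 * (indicator A a - indicator A b))"
        unfolding d_TV_def sK using * by (intro SUP_cong) auto
      also have "\<dots> = (1 - \<epsilon>)^m / 2"
      proof (rule cSup_eq_maximum)
        show "(1 - \<epsilon>)^m / 2 \<in> (\<lambda>A. (1 - \<epsilon>)^m / 2 * (indicator A a - indicator A b)) ` sets X"
          using ab by (intro image_eqI[of _ _ "{a}"]) (auto simp: sX)
      qed (use p in \<open>auto simp: indicator_def\<close>)
      finally show ?thesis .
    qed
    show ?thesis
    proof (rule rho_star_ge[OF Mtk X(1)])
      have "(\<lambda>m. ln (1 - \<epsilon>) - ln 2 / real m) \<longlonglongrightarrow> ln (1 - \<epsilon>) - 0"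
        by (intro tendsto_intros lim_const_over_n)
      moreover have "\<forall>\<^sub>F m in sequentially. ln (1 - \<epsilon>) - ln 2 / real m = ln ((1 - \<epsilon>)^m / 2) / real m"
        using r by (intro eventually_sequentiallyI[of 1]) (auto simp: ln_div ln_realpow field_simps)
      ultimately show "(\<lambda>m. ln (d_TV (kernel_power X Q m a) \<mu>) / real m) \<longlonglongrightarrow> ln (1 - \<epsilon>)"
        unfolding TV by (simp add: filterlim_cong)
    qed (use r in \<open>simp_all add: TV\<close>)
  qed
  also have "\<dots> \<le> rho_opt \<SS> (\<eta>, L, \<epsilon>, d)" by (rule rho_opt_ge[OF in_rates])
  finally show ?thesis .
qed

section \<open>Stationary mass of the small set\<close>

text \<open>Formally, integrating the drift inequality against the stationary law gives
  \<open>\<mu>(V) \<le> L / (1 - \<eta>)\<close>, and Markov's inequality bounds \<open>\<mu>{V > d}\<close> by \<open>L / ((1 - \<eta>) d) < 1/2\<close>. Since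
  \<open>\<mu>(V)\<close> might be infinite a priori, the argument is run with the truncation \<open>min V K\<close>, which is
  integrable and still satisfies \<open>P (min V K) \<le> min (\<eta> V + L) K\<close>.\<close>

lemma drift_small_set_mass:
  assumes P: "\<And>x. x \<in> space X \<Longrightarrow> sets (P x) = sets X \<and> emeasure (P x) (space X) \<le> 1"
    and \<mu>: "prob_space \<mu>" "sets \<mu> = sets X"
    and inv: "\<And>\<phi>. \<phi> \<in> borel_measurable X \<Longrightarrow> (\<integral>\<^sup>+x. (\<integral>\<^sup>+y. \<phi> y \<partial>P x) \<partial>\<mu>) = (\<integral>\<^sup>+x. \<phi> x \<partial>\<mu>)"
    and V[measurable]: "V \<in> borel_measurable X" and V0: "\<And>x. x \<in> space X \<Longrightarrow> 0 \<le> V x"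
    and drift: "\<And>x. x \<in> space X \<Longrightarrow> (\<integral>\<^sup>+y. ennreal (V y) \<partial>P x) \<le> ennreal (\<eta> * V x + L)"
    and pars: "0 \<le> \<eta>" "\<eta> < 1" "0 \<le> L" "0 < d" "d > 2 * L / (1 - \<eta>)"
  shows "measure \<mu> {x \<in> space X. V x \<le> d} > 1/2"
proof -
  interpret prob_space \<mu> by fact
  have sp: "space \<mu> = space X" using \<mu>(2) by (rule sets_eq_imp_space_eq)
  have [measurable_cong]: "sets \<mu> = sets X" by fact
  have trunc: "(1 - \<eta>) * d * measure \<mu> {x \<in> space X. d < V x \<and> V x \<le> K} \<le> L" if "K \<ge> 0" for K
  proof -
    let ?A = "{x \<in> space X. d < V x \<and> V x \<le> K}"
    have "(\<integral>\<^sup>+x. ennreal (min (V x) K) \<partial>\<mu>) = (\<integral>\<^sup>+x. (\<integral>\<^sup>+y. ennreal (min (V y) K) \<partial>P x) \<partial>\<mu>)"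
      by (rule inv[symmetric]) simp
    also have "\<dots> \<le> (\<integral>\<^sup>+x. ennreal (min (\<eta> * V x + L) K) \<partial>\<mu>)"
    proof (rule nn_integral_mono)
      fix x assume "x \<in> space \<mu>"
      then have x: "x \<in> space X" by (simp add: sp)
      have "(\<integral>\<^sup>+y. ennreal (min (V y) K) \<partial>P x) \<le> (\<integral>\<^sup>+y. ennreal (V y) \<partial>P x)"
        by (intro nn_integral_mono ennreal_leI) simp
      moreover have "(\<integral>\<^sup>+y. ennreal (min (V y) K) \<partial>P x) \<le> (\<integral>\<^sup>+y. ennreal K \<partial>P x)"
        by (intro nn_integral_mono ennreal_leI) simp
      moreover have "(\<integral>\<^sup>+y. ennreal K \<partial>P x) \<le> ennreal K"
        using P[OF x] sets_eq_imp_space_eq[of "P x" X]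
        by (simp add: mult_left_le)
      ultimately show "(\<integral>\<^sup>+y. ennreal (min (V y) K) \<partial>P x) \<le> ennreal (min (\<eta> * V x + L) K)"
        using drift[OF x] by (auto simp: min_def)
    qed
    finally have le: "(\<integral>\<^sup>+x. ennreal (min (V x) K) \<partial>\<mu>) \<le> (\<integral>\<^sup>+x. ennreal (min (\<eta> * V x + L) K) \<partial>\<mu>)" .
    have i1: "integrable \<mu> (\<lambda>x. min (V x) K)"
      using V0 that by (intro integrable_const_bound[of _ K]) (auto simp: sp)
    have i2: "integrable \<mu> (\<lambda>x. min (\<eta> * V x + L) K)"
    proof (rule integrable_const_bound[of _ K])
      have "norm (min (\<eta> * V x + L) K) \<le> K" if "x \<in> space X" for x
        using V0[OF that] pars \<open>K \<ge> 0\<close> by (simp add: abs_le_iff min_def)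
      then show "AE x in \<mu>. norm (min (\<eta> * V x + L) K) \<le> K" by (auto simp: sp)
    qed simp
    have i3: "integrable \<mu> (\<lambda>x. (1 - \<eta>) * d * indicator ?A x)"
      by (intro integrable_mult_right integrable_real_indicator) (auto simp: less_top[symmetric])
    have "(\<integral>\<^sup>+x. ennreal (min (V x) K) \<partial>\<mu>) = ennreal (\<integral>x. min (V x) K \<partial>\<mu>)"
      using V0 that by (intro nn_integral_eq_integral[OF i1]) (auto simp: sp)
    moreover have "(\<integral>\<^sup>+x. ennreal (min (\<eta> * V x + L) K) \<partial>\<mu>) = ennreal (\<integral>x. min (\<eta> * V x + L) K \<partial>\<mu>)"
      using V0 that pars by (intro nn_integral_eq_integral[OF i2]) (auto simp: sp)
    moreover have "0 \<le> (\<integral>x. min (\<eta> * V x + L) K \<partial>\<mu>)"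
      using V0 that pars by (intro integral_nonneg_AE) (auto simp: sp)
    ultimately have "(\<integral>x. min (V x) K \<partial>\<mu>) \<le> (\<integral>x. min (\<eta> * V x + L) K \<partial>\<mu>)"
      using le by simp
    also have "\<dots> \<le> (\<integral>x. min (V x) K + L - (1 - \<eta>) * d * indicator ?A x \<partial>\<mu>)"
    proof (rule integral_mono)
      \<comment> \<open>Above the truncation level the left side is at most \<open>K = min V K\<close>; below it the drift gains
        \<open>(1 - \<eta>) V\<close>, which exceeds \<open>(1 - \<eta>) d\<close> outside the small set.\<close>
      fix x assume "x \<in> space \<mu>"
      then have v: "0 \<le> V x" and x: "x \<in> space X" using V0 by (auto simp: sp)
      have "\<eta> * V x \<le> V x" using v pars by (simp add: mult_left_le_one_le)
      moreover have "(1 - \<eta>) * d \<le> (1 - \<eta>) * V x" if "d \<le> V x"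
        using that pars by (intro mult_left_mono) auto
      ultimately show "min (\<eta> * V x + L) K \<le> min (V x) K + L - (1 - \<eta>) * d * indicator ?A x"
        using pars x by (auto simp: indicator_def min_def algebra_simps)
    qed (use i1 i2 i3 in auto)
    also have "\<dots> = (\<integral>x. min (V x) K + L \<partial>\<mu>) - (\<integral>x. (1 - \<eta>) * d * indicator ?A x \<partial>\<mu>)"
      using i1 i3 by (intro Bochner_Integration.integral_diff) auto
    also have "(\<integral>x. min (V x) K + L \<partial>\<mu>) = (\<integral>x. min (V x) K \<partial>\<mu>) + L"
      using i1 by (simp add: prob_space)
    also have "(\<integral>x. (1 - \<eta>) * d * indicator ?A x \<partial>\<mu>) = (1 - \<eta>) * d * measure \<mu> ?A"
      using sets.sets_into_space[of ?A \<mu>] by (simp add: Int_absorb2 sp)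
    finally show ?thesis by simp
  qed
  have "(\<lambda>k. measure \<mu> {x \<in> space X. d < V x \<and> V x \<le> real k})
      \<longlonglongrightarrow> measure \<mu> (\<Union>k. {x \<in> space X. d < V x \<and> V x \<le> real k})"
    by (rule finite_Lim_measure_incseq) (auto simp: incseq_def)
  also have "(\<Union>k. {x \<in> space X. d < V x \<and> V x \<le> real k}) = {x \<in> space X. d < V x}"
    using real_arch_simple by auto
  finally have "(\<lambda>k. (1 - \<eta>) * d * measure \<mu> {x \<in> space X. d < V x \<and> V x \<le> real k})
      \<longlonglongrightarrow> (1 - \<eta>) * d * measure \<mu> {x \<in> space X. d < V x}"
    by (intro tendsto_intros)
  then have "(1 - \<eta>) * d * measure \<mu> {x \<in> space X. d < V x} \<le> L"
    by (rule LIMSEQ_le_const2) (intro exI[of _ 0] allI impI trunc, simp)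
  moreover have "2 * L < (1 - \<eta>) * d" using pars by (simp add: field_simps)
  ultimately have "(1 - \<eta>) * d * (2 * measure \<mu> {x \<in> space X. d < V x}) < (1 - \<eta>) * d * 1" by linarith
  then have "measure \<mu> {x \<in> space X. d < V x} < 1/2" using pars by (simp add: zero_less_mult_iff)
  moreover have "measure \<mu> {x \<in> space X. V x \<le> d} = 1 - measure \<mu> {x \<in> space X. d < V x}"
    using prob_compl[of "{x \<in> space X. d < V x}"]
    by (simp add: sp set_diff_eq not_less cong: conj_cong)
  ultimately show ?thesis by simp
qed

section \<open>Metropolis--Hastings kernels\<close>

definition mh_accept :: "('a \<Rightarrow> real) \<Rightarrow> ('a \<Rightarrow> 'a \<Rightarrow> real) \<Rightarrow> 'a \<Rightarrow> 'a \<Rightarrow> real" where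
  "mh_accept p q x y = min 1 ((p y * q y x) / (p x * q x y))"

definition mh_kernel ::
    "'a measure \<Rightarrow> ('a \<Rightarrow> real) \<Rightarrow> ('a \<Rightarrow> 'a \<Rightarrow> real) \<Rightarrow> 'a \<Rightarrow> 'a measure" where
  "mh_kernel N p q x = measure_of (space N) (sets N)
     (\<lambda>A. \<integral>\<^sup>+y. ennreal (q x y * (mh_accept p q x y * indicator A y
               + (1 - mh_accept p q x y) * indicator A x)) \<partial>N)"

locale metropolis_hastings = sigma_finite_measure N for N :: "'a measure" +
  fixes p :: "'a \<Rightarrow> real" and q :: "'a \<Rightarrow> 'a \<Rightarrow> real"
  assumes p_measurable[measurable]: "p \<in> borel_measurable N"
    and q_measurable: "case_prod q \<in> borel_measurable (N \<Otimes>\<^sub>M N)"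
    and p_pos: "x \<in> space N \<Longrightarrow> 0 < p x"
    and q_pos: "x \<in> space N \<Longrightarrow> y \<in> space N \<Longrightarrow> 0 < q x y"
    and q_prob: "x \<in> space N \<Longrightarrow> (\<integral>\<^sup>+y. ennreal (q x y) \<partial>N) = 1"
begin

sublocale pair_sigma_finite N N ..

abbreviation "\<alpha> \<equiv> mh_accept p q"

lemma q_measurable'[measurable (raw)]:
  assumes "f \<in> M \<rightarrow>\<^sub>M N" "g \<in> M \<rightarrow>\<^sub>M N" shows "(\<lambda>z. q (f z) (g z)) \<in> borel_measurable M"
  using measurable_compose[OF measurable_Pair[OF assms] q_measurable] by simp

lemma accept_measurable[measurable (raw)]:
  assumes [measurable]: "f \<in> M \<rightarrow>\<^sub>M N" "g \<in> M \<rightarrow>\<^sub>M N"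
  shows "(\<lambda>z. \<alpha> (f z) (g z)) \<in> borel_measurable M"
  unfolding mh_accept_def by measurable

lemma accept_bounds:
  assumes "x \<in> space N" "y \<in> space N"
  shows "0 \<le> \<alpha> x y" "\<alpha> x y \<le> 1"
  using assms p_pos q_pos by (auto simp: mh_accept_def less_imp_le)

text \<open>Both sides equal \<open>min (p x * q x y) (p y * q y x)\<close>.\<close>

lemma detailed_balance:
  assumes "x \<in> space N" "y \<in> space N"
  shows "p x * (q x y * \<alpha> x y) = p y * (q y x * \<alpha> y x)"
  using assms p_pos[of x] p_pos[of y] q_pos[of x y] q_pos[of y x]
  by (auto simp: mh_accept_def min_def field_simps)

text \<open>The set function in the definition is countably additive because it is the law of an explicit
  random point: draw a pair of a proposal \<open>y\<close> and an accept/reject bit \<open>b\<close>, and return \<open>y\<close> or \<open>x\<close>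
  accordingly. Integrals against the kernel then follow by change of variables.\<close>

lemma mh_kernel_measure:
  assumes x: "x \<in> space N"
  shows sets_mh_kernel: "sets (mh_kernel N p q x) = sets N"
    and nn_integral_mh_kernel: "\<And>\<phi>. \<phi> \<in> borel_measurable N \<Longrightarrow> (\<integral>\<^sup>+z. \<phi> z \<partial>mh_kernel N p q x)
      = (\<integral>\<^sup>+y. ennreal (q x y * \<alpha> x y) * \<phi> y + ennreal (q x y * (1 - \<alpha> x y)) * \<phi> x \<partial>N)"
proof -
  let ?B = "count_space (UNIV :: bool set)"
  interpret B: sigma_finite_measure ?B by (rule sigma_finite_measure_count_space)
  define w where "w = (\<lambda>(y, b). ennreal (q x y * (if b then \<alpha> x y else 1 - \<alpha> x y)))"
  define \<kappa> where "\<kappa> = distr (density (N \<Otimes>\<^sub>M ?B) w) N (\<lambda>(y, b). if b then y else x)"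
  have [measurable]: "w \<in> borel_measurable (N \<Otimes>\<^sub>M ?B)" unfolding w_def using x by measurable
  have [measurable]: "(\<lambda>(y, b). if b then y else x) \<in> N \<Otimes>\<^sub>M ?B \<rightarrow>\<^sub>M N" using x by measurable
  have int: "(\<integral>\<^sup>+z. \<phi> z \<partial>\<kappa>)
      = (\<integral>\<^sup>+y. ennreal (q x y * \<alpha> x y) * \<phi> y + ennreal (q x y * (1 - \<alpha> x y)) * \<phi> x \<partial>N)"
    if [measurable]: "\<phi> \<in> borel_measurable N" for \<phi>
  proof -
    have "(\<integral>\<^sup>+z. \<phi> z \<partial>\<kappa>) = (\<integral>\<^sup>+z. w z * \<phi> (case z of (y, b) \<Rightarrow> if b then y else x) \<partial>(N \<Otimes>\<^sub>M ?B))"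
      unfolding \<kappa>_def by (simp add: nn_integral_distr nn_integral_density)
    also have "\<dots> = (\<integral>\<^sup>+y. \<integral>\<^sup>+b. w (y, b) * \<phi> (if b then y else x) \<partial>?B \<partial>N)"
      by (subst B.nn_integral_fst[symmetric]) simp_all
    also have "\<dots> = (\<integral>\<^sup>+y. ennreal (q x y * \<alpha> x y) * \<phi> y + ennreal (q x y * (1 - \<alpha> x y)) * \<phi> x \<partial>N)"
      by (simp add: nn_integral_count_space_finite UNIV_bool w_def add.commute)
    finally show ?thesis .
  qed
  have "mh_kernel N p q x = measure_of (space N) (sets N) (emeasure \<kappa>)"
    unfolding mh_kernel_def
  proof (rule measure_of_eq[OF sets.space_closed])
    fix A assume "A \<in> sigma_sets (space N) (sets N)"
    then have A[measurable]: "A \<in> sets N" by (simp add: sets.sigma_sets_eq)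
    have "emeasure \<kappa> A = (\<integral>\<^sup>+z. indicator A z \<partial>\<kappa>)"
      by (simp add: \<kappa>_def)
    also have "\<dots> = (\<integral>\<^sup>+y. ennreal (q x y * \<alpha> x y) * indicator A y + ennreal (q x y * (1 - \<alpha> x y))
        * indicator A x \<partial>N)"
      by (rule int) simp
    also have "\<dots> = (\<integral>\<^sup>+y. ennreal (q x y * (\<alpha> x y * indicator A y + (1 - \<alpha> x y) * indicator A x)) \<partial>N)"
    proof (rule nn_integral_cong)
      fix y assume y: "y \<in> space N"
      show "ennreal (q x y * \<alpha> x y) * indicator A y + ennreal (q x y * (1 - \<alpha> x y)) * indicator A x
        = ennreal (q x y * (\<alpha> x y * indicator A y + (1 - \<alpha> x y) * indicator A x))"
        using accept_bounds[OF x y] q_pos[OF x y]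
        by (auto simp: indicator_def field_simps simp flip: ennreal_plus)
    qed
    finally show "(\<integral>\<^sup>+y. ennreal (q x y * (\<alpha> x y * indicator A y + (1 - \<alpha> x y) * indicator A x)) \<partial>N)
      = emeasure \<kappa> A" by simp
  qed
  also have "\<dots> = \<kappa>"
    using measure_of_of_measure[of \<kappa>] by (simp add: \<kappa>_def)
  finally have eq: "mh_kernel N p q x = \<kappa>" .
  show "sets (mh_kernel N p q x) = sets N" unfolding eq by (simp add: \<kappa>_def)
  show "\<And>\<phi>. \<phi> \<in> borel_measurable N \<Longrightarrow> (\<integral>\<^sup>+z. \<phi> z \<partial>mh_kernel N p q x)
      = (\<integral>\<^sup>+y. ennreal (q x y * \<alpha> x y) * \<phi> y + ennreal (q x y * (1 - \<alpha> x y)) * \<phi> x \<partial>N)"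
    unfolding eq by (rule int)
qed

lemma emeasure_mh_kernel_space:
  assumes x: "x \<in> space N" shows "emeasure (mh_kernel N p q x) (space N) = 1"
proof -
  have "emeasure (mh_kernel N p q x) (space N) = (\<integral>\<^sup>+z. 1 \<partial>mh_kernel N p q x)"
    using sets_eq_imp_space_eq[OF sets_mh_kernel[OF x]] by simp
  also have "\<dots> = (\<integral>\<^sup>+y. ennreal (q x y) \<partial>N)"
    unfolding nn_integral_mh_kernel[OF x borel_measurable_const]
    using accept_bounds[OF x] q_pos[OF x]
    by (intro nn_integral_cong) (auto simp: less_imp_le field_simps simp flip: ennreal_plus)
  finally show ?thesis using q_prob[OF x] by simp
qed

text \<open>The accepted flow from \<open>x\<close> to \<open>y\<close> is symmetric by detailed balance, so swapping the integrals
  turns the mass arriving at a point into the mass leaving it; together with the rejected mass,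
  which does not move, this is all of \<open>p\<close>.\<close>

lemma mh_stationary:
  assumes [measurable]: "\<phi> \<in> borel_measurable N"
  shows "(\<integral>\<^sup>+x. (\<integral>\<^sup>+z. \<phi> z \<partial>mh_kernel N p q x) \<partial>density N (\<lambda>x. ennreal (p x)))
    = (\<integral>\<^sup>+x. \<phi> x \<partial>density N (\<lambda>x. ennreal (p x)))"
proof -
  \<comment> \<open>Accepted flow \<open>m\<close> and rejected flow \<open>r\<close>; they add up to \<open>p x * q x y\<close>.\<close>
  define m where "m x y = ennreal (p x * (q x y * \<alpha> x y))" for x y
  define r where "r x y = ennreal (p x * (q x y * (1 - \<alpha> x y)))" for x y
  have [measurable]: "case_prod m \<in> borel_measurable (N \<Otimes>\<^sub>M N)" "case_prod r \<in> borel_measurable (N \<Otimes>\<^sub>M N)"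
    unfolding m_def r_def by measurable
  have split: "ennreal (p x) * (\<integral>\<^sup>+z. \<phi> z \<partial>mh_kernel N p q x)
      = (\<integral>\<^sup>+y. m x y * \<phi> y \<partial>N) + (\<integral>\<^sup>+y. r x y * \<phi> x \<partial>N)" if x: "x \<in> space N" for x
  proof -
    note [measurable] = x
    have "ennreal (p x) * (\<integral>\<^sup>+z. \<phi> z \<partial>mh_kernel N p q x)
      = (\<integral>\<^sup>+y. ennreal (p x) * (ennreal (q x y * \<alpha> x y) * \<phi> y
          + ennreal (q x y * (1 - \<alpha> x y)) * \<phi> x) \<partial>N)"
      unfolding nn_integral_mh_kernel[OF x assms] by (rule nn_integral_cmult[symmetric]) measurable
    also have "\<dots> = (\<integral>\<^sup>+y. m x y * \<phi> y + r x y * \<phi> x \<partial>N)"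
      using accept_bounds[OF x] q_pos[OF x] p_pos[OF x]
      by (intro nn_integral_cong)
        (simp add: m_def r_def ennreal_mult[of "p x"] less_imp_le distrib_left mult.assoc)
    also have "\<dots> = (\<integral>\<^sup>+y. m x y * \<phi> y \<partial>N) + (\<integral>\<^sup>+y. r x y * \<phi> x \<partial>N)"
      by (rule nn_integral_add) measurable
    finally show ?thesis .
  qed
  have "(\<integral>\<^sup>+x. (\<integral>\<^sup>+z. \<phi> z \<partial>mh_kernel N p q x) \<partial>density N (\<lambda>x. ennreal (p x)))
      = (\<integral>\<^sup>+x. ennreal (p x) * (\<integral>\<^sup>+z. \<phi> z \<partial>mh_kernel N p q x) \<partial>N)"
  proof (rule nn_integral_density)
    show "(\<lambda>x. \<integral>\<^sup>+z. \<phi> z \<partial>mh_kernel N p q x) \<in> borel_measurable N"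
      by (subst measurable_cong[OF nn_integral_mh_kernel[OF _ assms]]) measurable
  qed simp
  also have "\<dots> = (\<integral>\<^sup>+x. (\<integral>\<^sup>+y. m x y * \<phi> y \<partial>N) + (\<integral>\<^sup>+y. r x y * \<phi> x \<partial>N) \<partial>N)"
    by (rule nn_integral_cong) (rule split)
  also have "\<dots> = (\<integral>\<^sup>+x. \<integral>\<^sup>+y. m x y * \<phi> y \<partial>N \<partial>N) + (\<integral>\<^sup>+x. \<integral>\<^sup>+y. r x y * \<phi> x \<partial>N \<partial>N)"
    by (rule nn_integral_add) measurable
  also have "(\<integral>\<^sup>+x. \<integral>\<^sup>+y. m x y * \<phi> y \<partial>N \<partial>N) = (\<integral>\<^sup>+y. \<integral>\<^sup>+x. m x y * \<phi> y \<partial>N \<partial>N)"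
    by (rule Fubini'[symmetric]) measurable
  also have "\<dots> = (\<integral>\<^sup>+y. \<integral>\<^sup>+x. m y x * \<phi> y \<partial>N \<partial>N)"
    by (intro nn_integral_cong) (simp add: m_def detailed_balance)
  also have "\<dots> + (\<integral>\<^sup>+x. \<integral>\<^sup>+y. r x y * \<phi> x \<partial>N \<partial>N)
      = (\<integral>\<^sup>+x. (\<integral>\<^sup>+y. m x y * \<phi> x \<partial>N) + (\<integral>\<^sup>+y. r x y * \<phi> x \<partial>N) \<partial>N)"
    by (rule nn_integral_add[symmetric]) measurable
  also have "\<dots> = (\<integral>\<^sup>+x. ennreal (p x) * \<phi> x \<partial>N)"
  proof (rule nn_integral_cong)
    fix x assume x[measurable]: "x \<in> space N"
    have "(\<integral>\<^sup>+y. m x y * \<phi> x \<partial>N) + (\<integral>\<^sup>+y. r x y * \<phi> x \<partial>N) = (\<integral>\<^sup>+y. m x y * \<phi> x + r x y * \<phi> x \<partial>N)"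
      by (rule nn_integral_add[symmetric]) measurable
    also have "\<dots> = (\<integral>\<^sup>+y. ennreal (p x) * \<phi> x * ennreal (q x y) \<partial>N)"
    proof (rule nn_integral_cong)
      fix y assume y: "y \<in> space N"
      have "m x y + r x y = ennreal (p x) * ennreal (q x y)"
        using accept_bounds[OF x y] q_pos[OF x y] p_pos[OF x]
        by (simp add: m_def r_def algebra_simps flip: ennreal_plus ennreal_mult)
      then show "m x y * \<phi> x + r x y * \<phi> x = ennreal (p x) * \<phi> x * ennreal (q x y)"
        by (simp add: distrib_right[symmetric]) (simp add: mult_ac)
    qed
    also have "\<dots> = ennreal (p x) * \<phi> x"
      using q_prob[OF x] by (subst nn_integral_cmult) auto
    finally show "(\<integral>\<^sup>+y. m x y * \<phi> x \<partial>N) + (\<integral>\<^sup>+y. r x y * \<phi> x \<partial>N) = ennreal (p x) * \<phi> x" .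
  qed
  also have "\<dots> = (\<integral>\<^sup>+x. \<phi> x \<partial>density N (\<lambda>x. ennreal (p x)))"
    by (rule nn_integral_density[symmetric]) auto
  finally show ?thesis .
qed

text \<open>Only accepted proposals reach sets that avoid the current state.\<close>

lemma mh_kernel_le_proposal:
  assumes x: "x \<in> space N" "x \<notin> A" and A: "A \<in> sets N"
  shows "emeasure (mh_kernel N p q x) A \<le> (\<integral>\<^sup>+y. ennreal (q x y) * indicator A y \<partial>N)"
proof -
  have "emeasure (mh_kernel N p q x) A = (\<integral>\<^sup>+z. indicator A z \<partial>mh_kernel N p q x)"
    using A by (simp add: sets_mh_kernel[OF x(1)])
  also have "\<dots> = (\<integral>\<^sup>+y. ennreal (q x y * \<alpha> x y) * indicator A y \<partial>N)"
    using x(2) A by (subst nn_integral_mh_kernel[OF x(1)]) auto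
  also have "\<dots> \<le> (\<integral>\<^sup>+y. ennreal (q x y) * indicator A y \<partial>N)"
    using accept_bounds[OF x(1)] q_pos[OF x(1)]
    by (intro nn_integral_mono mult_right_mono ennreal_leI) (auto simp: mult_left_le less_imp_le)
  finally show ?thesis .
qed

end

section \<open>Gaussian tails and product densities\<close>

lemma nn_integral_normal_density:
  assumes "\<sigma> > 0" shows "(\<integral>\<^sup>+t. ennreal (normal_density \<mu> \<sigma> t) \<partial>lborel) = 1"
  using assms by (subst nn_integral_eq_integral) auto

text \<open>The exponential Markov inequality: on the tail the density is dominated by a multiple of the
  normal density with twice the variance, at the price of half the exponent.\<close>

lemma normal_tail:
  assumes "\<sigma> > 0" "r \<ge> 0"
  shows "(\<integral>\<^sup>+t. ennreal (normal_density \<mu> \<sigma> t) * indicator {t. r \<le> \<bar>t - \<mu>\<bar>} t \<partial>lborel)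
    \<le> ennreal (sqrt 2 * exp (- r\<^sup>2 / (4 * \<sigma>\<^sup>2)))"
proof -
  have pw: "normal_density \<mu> \<sigma> t * indicator {t. r \<le> \<bar>t - \<mu>\<bar>} t
      \<le> sqrt 2 * exp (- r\<^sup>2 / (4 * \<sigma>\<^sup>2)) * normal_density \<mu> (sqrt 2 * \<sigma>) t" for t
  proof (cases "r \<le> \<bar>t - \<mu>\<bar>")
    case True
    then have "r\<^sup>2 \<le> (t - \<mu>)\<^sup>2" using assms by (metis abs_of_nonneg abs_le_square_iff)
    then have "- (t - \<mu>)\<^sup>2 / (2 * \<sigma>\<^sup>2) \<le> - r\<^sup>2 / (4 * \<sigma>\<^sup>2) + - (t - \<mu>)\<^sup>2 / (4 * \<sigma>\<^sup>2)"
      using assms by (simp add: field_simps)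
    then have "exp (- (t - \<mu>)\<^sup>2 / (2 * \<sigma>\<^sup>2)) \<le> exp (- r\<^sup>2 / (4 * \<sigma>\<^sup>2)) * exp (- (t - \<mu>)\<^sup>2 / (4 * \<sigma>\<^sup>2))"
      by (simp flip: exp_add)
    then have "1 / sqrt (2 * pi * \<sigma>\<^sup>2) * exp (- (t - \<mu>)\<^sup>2 / (2 * \<sigma>\<^sup>2))
       \<le> 1 / sqrt (2 * pi * \<sigma>\<^sup>2) * (exp (- r\<^sup>2 / (4 * \<sigma>\<^sup>2)) * exp (- (t - \<mu>)\<^sup>2 / (4 * \<sigma>\<^sup>2)))"
      by (rule mult_left_mono) simp
    moreover have "sqrt (2 * pi * (sqrt 2 * \<sigma>)\<^sup>2) = sqrt 2 * sqrt (2 * pi * \<sigma>\<^sup>2)"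
      by (simp add: power_mult_distrib flip: real_sqrt_mult)
    moreover have "2 * (sqrt 2 * \<sigma>)\<^sup>2 = 4 * \<sigma>\<^sup>2" by (simp add: power_mult_distrib)
    ultimately show ?thesis using True
      unfolding normal_density_def by simp
  qed simp
  have "(\<integral>\<^sup>+t. ennreal (normal_density \<mu> \<sigma> t) * indicator {t. r \<le> \<bar>t - \<mu>\<bar>} t \<partial>lborel)
     = (\<integral>\<^sup>+t. ennreal (normal_density \<mu> \<sigma> t * indicator {t. r \<le> \<bar>t - \<mu>\<bar>} t) \<partial>lborel)"
    by (intro nn_integral_cong) (auto simp: indicator_def)
  also have "\<dots> \<le> (\<integral>\<^sup>+t. ennreal (sqrt 2 * exp (- r\<^sup>2 / (4 * \<sigma>\<^sup>2))) * ennreal (normal_density \<mu> (sqrt 2 * \<sigma>) t) \<partial>lborel)"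
    using pw by (intro nn_integral_mono) (simp flip: ennreal_mult add: ennreal_leI)
  also have "\<dots> = ennreal (sqrt 2 * exp (- r\<^sup>2 / (4 * \<sigma>\<^sup>2)))"
    using assms by (subst nn_integral_cmult) (auto simp: nn_integral_normal_density)
  finally show ?thesis .
qed

text \<open>Under a product of probability densities, an event that concerns a single coordinate only sees
  the marginal of that coordinate.\<close>

lemma nn_integral_prod_cylinder:
  fixes f :: "'i \<Rightarrow> real \<Rightarrow> real"
  assumes I: "finite I" "k \<in> I"
    and f[measurable]: "\<And>i. f i \<in> borel_measurable borel" and f0: "\<And>i t. 0 \<le> f i t"
    and f1: "\<And>i. i \<in> I \<Longrightarrow> (\<integral>\<^sup>+t. ennreal (f i t) \<partial>lborel) = 1"
    and S[measurable]: "S \<in> sets borel"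
  shows "(\<integral>\<^sup>+y. ennreal (\<Prod>i\<in>I. f i (y i))
      * indicator {y \<in> space (Pi\<^sub>M I (\<lambda>_. lborel)). y k \<in> S} y \<partial>Pi\<^sub>M I (\<lambda>_. lborel))
    = (\<integral>\<^sup>+t. ennreal (f k t) * indicator S t \<partial>lborel)"
proof -
  interpret product_sigma_finite "\<lambda>_::'i. lborel :: real measure" ..
  define F where "F i t = (if i = k then ennreal (f k t) * indicator S t else ennreal (f i t))" for i t
  have Fk: "F k = (\<lambda>t. ennreal (f k t) * indicator S t)"
    and Fi: "i \<noteq> k \<Longrightarrow> F i = (\<lambda>t. ennreal (f i t))" for i
    by (auto simp: F_def)
  have F[measurable]: "F i \<in> borel_measurable lborel" for i
    unfolding F_def by (cases "i = k") simp_all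
  have "(\<integral>\<^sup>+y. ennreal (\<Prod>i\<in>I. f i (y i))
      * indicator {y \<in> space (Pi\<^sub>M I (\<lambda>_. lborel)). y k \<in> S} y \<partial>Pi\<^sub>M I (\<lambda>_. lborel))
     = (\<integral>\<^sup>+y. (\<Prod>i\<in>I. F i (y i)) \<partial>Pi\<^sub>M I (\<lambda>_. lborel))"
  proof (rule nn_integral_cong)
    fix y :: "'i \<Rightarrow> real" assume y: "y \<in> space (Pi\<^sub>M I (\<lambda>_. lborel))"
    have "(\<Prod>i\<in>I. F i (y i)) = F k (y k) * (\<Prod>i\<in>I-{k}. F i (y i))"
      by (rule prod.remove[OF I])
    also have "(\<Prod>i\<in>I-{k}. F i (y i)) = (\<Prod>i\<in>I-{k}. ennreal (f i (y i)))"
      by (rule prod.cong) (auto simp: F_def)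
    also have "F k (y k) * \<dots> = (\<Prod>i\<in>I. ennreal (f i (y i))) * indicator S (y k)"
      by (subst prod.remove[OF I]) (simp add: F_def mult_ac)
    also have "\<dots> = ennreal (\<Prod>i\<in>I. f i (y i)) * indicator {y \<in> space (Pi\<^sub>M I (\<lambda>_. lborel)). y k \<in> S} y"
      using y by (simp add: prod_ennreal f0 indicator_def)
    finally show "ennreal (\<Prod>i\<in>I. f i (y i)) * indicator {y \<in> space (Pi\<^sub>M I (\<lambda>_. lborel)). y k \<in> S} y
        = (\<Prod>i\<in>I. F i (y i))" by simp
  qed
  also have "\<dots> = (\<Prod>i\<in>I. integral\<^sup>N lborel (F i))"
    by (rule product_nn_integral_prod[OF I(1) F])
  also have "\<dots> = integral\<^sup>N lborel (F k) * (\<Prod>i\<in>I-{k}. integral\<^sup>N lborel (F i))"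
    by (rule prod.remove[OF I])
  also have "(\<Prod>i\<in>I-{k}. integral\<^sup>N lborel (F i)) = 1"
    by (rule prod.neutral) (auto simp: Fi f1)
  finally show ?thesis by (simp add: Fk)
qed

lemma nn_integral_prod_density:
  fixes f :: "'i \<Rightarrow> real \<Rightarrow> real"
  assumes I: "finite I"
    and f[measurable]: "\<And>i. f i \<in> borel_measurable borel" and f0: "\<And>i t. 0 \<le> f i t"
    and f1: "\<And>i. i \<in> I \<Longrightarrow> (\<integral>\<^sup>+t. ennreal (f i t) \<partial>lborel) = 1"
  shows "(\<integral>\<^sup>+y. ennreal (\<Prod>i\<in>I. f i (y i)) \<partial>Pi\<^sub>M I (\<lambda>_. lborel)) = 1"
proof -
  interpret product_sigma_finite "\<lambda>_::'i. lborel :: real measure" ..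
  show ?thesis
    using product_nn_integral_prod[OF I, of "\<lambda>i t. ennreal (f i t)"] f1 f0
    by (simp add: prod_ennreal)
qed

section \<open>Langevin proposals for a product target\<close>

locale product_target =
  fixes g :: "real \<Rightarrow> real" and M B :: real
  assumes g_pos: "\<And>x. g x > 0"
    and g_diff: "\<And>x. g differentiable (at x)"
    and g_prob: "(\<integral>\<^sup>+x. ennreal (g x) \<partial>lborel) = 1"
    and g_le: "\<And>x. g x \<le> B"
    and score_Lipschitz:
      "\<And>x y. \<bar>- deriv (\<lambda>t. ln (g t)) x + deriv (\<lambda>t. ln (g t)) y\<bar> \<le> M * \<bar>x - y\<bar>"
begin

abbreviation "score \<equiv> deriv (\<lambda>t. ln (g t))"

definition target :: "nat \<Rightarrow> (nat \<Rightarrow> real) \<Rightarrow> real" where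
  "target n x = (\<Prod>i<n. g (x i))"

text \<open>The normalised proposal density: independent Gaussian coordinates with means
  \<open>x\<^sub>i + h (log g)'(x\<^sub>i)\<close> and variance \<open>2h\<close>.\<close>

definition langevin :: "nat \<Rightarrow> real \<Rightarrow> (nat \<Rightarrow> real) \<Rightarrow> (nat \<Rightarrow> real) \<Rightarrow> real" where
  "langevin n h x y = (\<Prod>i<n. normal_density (x i + h * score (x i)) (sqrt (2 * h)) (y i))"

lemma B_pos: "B > 0" using g_pos[of 0] g_le[of 0] by linarith

lemma M_nonneg: "M \<ge> 0" using score_Lipschitz[of 1 0] by simp

lemma g_measurable[measurable]: "g \<in> borel_measurable borel"
  by (intro borel_measurable_continuous_onI continuous_at_imp_continuous_on ballI
      differentiable_imp_continuous_within[OF g_diff])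

lemma score_measurable[measurable]: "score \<in> borel_measurable borel"
proof -
  have "M-lipschitz_on UNIV score"
    using score_Lipschitz M_nonneg by (intro lipschitz_onI) (auto simp: dist_real_def abs_minus_commute)
  then show ?thesis
    by (intro borel_measurable_continuous_onI lipschitz_on_continuous_on)
qed

lemma target_pos: "target n x > 0"
  unfolding target_def by (intro prod_pos) (simp add: g_pos)

lemma gradient_neg_ln_target:
  assumes "i < n" shows "gradient (\<lambda>z. - ln (target n z)) x i = - score (x i)"
proof -
  have ln_target: "- ln (target n (x(i := t))) = - ln (g t) - (\<Sum>j\<in>{..<n}-{i}. ln (g (x j)))" for t
  proof -
    have "ln (target n (x(i := t))) = (\<Sum>j<n. ln (g ((x(i := t)) j)))"
      unfolding target_def by (rule ln_prod) (auto simp: g_pos less_imp_neq[OF g_pos, symmetric])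
    also have "\<dots> = ln (g t) + (\<Sum>j\<in>{..<n}-{i}. ln (g ((x(i := t)) j)))"
      using assms by (subst sum.remove[of _ i]) auto
    also have "(\<Sum>j\<in>{..<n}-{i}. ln (g ((x(i := t)) j))) = (\<Sum>j\<in>{..<n}-{i}. ln (g (x j)))"
      by (rule sum.cong) auto
    finally show ?thesis by linarith
  qed
  obtain D where "(g has_real_derivative D) (at (x i))"
    using g_diff[of "x i"] by (auto simp: real_differentiable_def)
  then have "((\<lambda>t. ln (g t)) has_real_derivative D / g (x i)) (at (x i))"
    using g_pos[of "x i"] by (auto intro!: derivative_eq_intros)
  then have "((\<lambda>t. ln (g t)) has_real_derivative score (x i)) (at (x i))"
    using DERIV_imp_deriv by metis
  then have "((\<lambda>t. - ln (g t) - (\<Sum>j\<in>{..<n}-{i}. ln (g (x j)))) has_real_derivative - score (x i))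
      (at (x i))"
    using DERIV_diff[OF DERIV_minus DERIV_const] by fastforce
  then show ?thesis unfolding gradient_def ln_target by (rule DERIV_imp_deriv)
qed

lemma langevin_eq_mala_weight:
  assumes "h > 0"
  shows "(4 * pi * h) powr (- real n / 2) * mala_weight n (target n) h x y = langevin n h x y"
proof -
  have c: "(4 * pi * h) powr (- real n / 2) = (1 / sqrt (4 * pi * h)) ^ n"
  proof -
    have "(4 * pi * h) powr (- real n / 2) = ((4 * pi * h) powr (-1/2)) powr real n"
      by (simp add: powr_powr)
    also have "(4 * pi * h) powr (-1/2) = 1 / sqrt (4 * pi * h)"
      using assms by (simp add: powr_minus_divide powr_half_sqrt)
    finally show ?thesis using assms by (simp add: powr_realpow)
  qed
  have "mala_weight n (target n) h x y = exp (\<Sum>i<n. - (y i - (x i + h * score (x i)))\<^sup>2 / (4 * h))"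
  proof -
    have "(L2_set (\<lambda>i. y i - x i + h * gradient (\<lambda>z. - ln (target n z)) x i) {..<n})\<^sup>2
        = (\<Sum>i<n. (y i - (x i + h * score (x i)))\<^sup>2)"
      unfolding L2_set_def by (simp add: sum_nonneg gradient_neg_ln_target diff_diff_eq)
    then show ?thesis
      unfolding mala_weight_def by (simp add: sum_divide_distrib sum_negf)
  qed
  also have "\<dots> = (\<Prod>i<n. exp (- (y i - (x i + h * score (x i)))\<^sup>2 / (4 * h)))"
    by (rule exp_sum) simp
  finally show ?thesis
    using assms unfolding langevin_def normal_density_def c
    by (simp add: prod.distrib prod_dividef power_divide mult.assoc)
qed

text \<open>The normalising constant of the proposal does not depend on the starting point, so it cancels
  in the acceptance ratio.\<close>

lemma mala_eq_mh_kernel: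
  assumes "h > 0"
  shows "mala_kernel n (target n) h x = mh_kernel (lborel_Rn n) (target n) (langevin n h) x"
proof -
  let ?c = "(4 * pi * h) powr (- real n / 2)"
  have "?c > 0" using assms by simp
  then have "mh_accept (target n) (langevin n h) u v = mala_accept n (target n) h u v" for u v
    unfolding mh_accept_def mala_accept_def langevin_eq_mala_weight[OF assms, symmetric] by simp
  moreover have "sets (Rn n) = sets (lborel_Rn n)" by (rule sets_PiM_cong) auto
  moreover have "space (Rn n) = space (lborel_Rn n)" by (simp add: space_PiM)
  ultimately show ?thesis
    unfolding mala_kernel_def mh_kernel_def langevin_eq_mala_weight[OF assms] by simp
qed

lemma target_prob: "(\<integral>\<^sup>+x. ennreal (target n x) \<partial>lborel_Rn n) = 1"
  unfolding target_def by (intro nn_integral_prod_density) (auto simp: g_prob g_pos less_imp_le)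

lemma langevin_mh:
  assumes h: "h > 0"
  shows "metropolis_hastings (lborel_Rn n) (target n) (langevin n h)"
proof -
  interpret product_sigma_finite "\<lambda>_::nat. lborel :: real measure" ..
  interpret sigma_finite_measure "lborel_Rn n" by (rule sigma_finite) simp
  show ?thesis
  proof
    show "target n \<in> borel_measurable (lborel_Rn n)" unfolding target_def by measurable
    show "case_prod (langevin n h) \<in> borel_measurable (lborel_Rn n \<Otimes>\<^sub>M lborel_Rn n)"
      unfolding langevin_def normal_density_def by measurable
    fix x y
    show "0 < target n x" by (rule target_pos)
    show "0 < langevin n h x y"
      unfolding langevin_def using h by (intro prod_pos ballI normal_density_pos) simp
    show "(\<integral>\<^sup>+y. ennreal (langevin n h x y) \<partial>lborel_Rn n) = 1"
      unfolding langevin_def using h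
      by (intro nn_integral_prod_density nn_integral_normal_density) auto
  qed
qed

lemma sets_cylinder:
  assumes "n \<ge> 1" "S \<in> sets borel"
  shows "{y \<in> space (lborel_Rn n). y 0 \<in> S} \<in> sets (lborel_Rn n)"
proof -
  have "(\<lambda>y. y 0) \<in> lborel_Rn n \<rightarrow>\<^sub>M lborel"
    using assms(1) by (intro measurable_component_singleton) simp
  from measurable_sets[OF this, of S] assms(2) show ?thesis
    by (simp add: vimage_def Int_def conj_commute)
qed

text \<open>If all points of \<open>C\<close> had first coordinates within \<open>1/(4B)\<close> of each other, then \<open>C\<close> would lie in a
  slab of width \<open>1/(2B)\<close>, and such a slab has mass at most \<open>1/2\<close> since the first marginal \<open>g\<close> is
  bounded by \<open>B\<close>. The width does not depend on the dimension.\<close>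

lemma small_set_spread:
  assumes n: "n \<ge> 1" and C: "C \<in> sets (lborel_Rn n)"
    and mass: "emeasure (density (lborel_Rn n) (\<lambda>x. ennreal (target n x))) C > ennreal (1/2)"
  shows "\<exists>x\<in>C. \<exists>y\<in>C. 1 / (4 * B) \<le> \<bar>x 0 - y 0\<bar>"
proof (rule ccontr)
  assume "\<not> ?thesis"
  then have near: "\<bar>x 0 - y 0\<bar> < 1 / (4 * B)" if "x \<in> C" "y \<in> C" for x y using that by force
  have "C \<noteq> {}" using mass by auto
  then obtain x where x: "x \<in> C" by auto
  define S where "S = {x 0 - 1 / (4 * B) .. x 0 + 1 / (4 * B)}"
  have CS: "C \<subseteq> {y \<in> space (lborel_Rn n). y 0 \<in> S}"
    using near[OF x] sets.sets_into_space[OF C] by (force simp: S_def abs_less_iff)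
  have [measurable]: "target n \<in> borel_measurable (lborel_Rn n)" unfolding target_def by measurable
  have [measurable]: "{y \<in> space (lborel_Rn n). y 0 \<in> S} \<in> sets (lborel_Rn n)"
    using n by (intro sets_cylinder) (auto simp: S_def)
  have "emeasure (density (lborel_Rn n) (\<lambda>x. ennreal (target n x))) C
     \<le> emeasure (density (lborel_Rn n) (\<lambda>x. ennreal (target n x))) {y \<in> space (lborel_Rn n). y 0 \<in> S}"
    by (rule emeasure_mono[OF CS]) simp
  also have "\<dots> = (\<integral>\<^sup>+y. ennreal (target n y)
      * indicator {y \<in> space (lborel_Rn n). y 0 \<in> S} y \<partial>lborel_Rn n)"
    by (rule emeasure_density) auto
  also have "\<dots> = (\<integral>\<^sup>+t. ennreal (g t) * indicator S t \<partial>lborel)"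
    unfolding target_def using n
    by (intro nn_integral_prod_cylinder[where f="\<lambda>_. g"]) (auto simp: g_prob g_pos less_imp_le S_def)
  also have "\<dots> \<le> (\<integral>\<^sup>+t. ennreal B * indicator S t \<partial>lborel)"
    by (intro nn_integral_mono mult_right_mono ennreal_leI g_le) auto
  also have "\<dots> = ennreal B * ennreal (1 / (2 * B))"
    using B_pos by (subst nn_integral_cmult_indicator) (auto simp: S_def)
  also have "\<dots> = ennreal (1/2)" using B_pos by (simp flip: ennreal_mult)
  finally show False using mass by simp
qed

text \<open>Excluding \<open>x\<^sub>0\<close> from \<open>S\<close> removes the atom that rejected proposals leave at \<open>x\<close>.\<close>

lemma mala_cylinder_le:
  assumes n: "n \<ge> 1" and h: "h > 0" and x: "x \<in> space (lborel_Rn n)"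
    and S[measurable]: "S \<in> sets borel" "x 0 \<notin> S"
  shows "emeasure (mala_kernel n (target n) h x) {y \<in> space (lborel_Rn n). y 0 \<in> S}
    \<le> (\<integral>\<^sup>+t. ennreal (normal_density (x 0 + h * score (x 0)) (sqrt (2 * h)) t) * indicator S t \<partial>lborel)"
proof -
  interpret metropolis_hastings "lborel_Rn n" "target n" "langevin n h" by (rule langevin_mh[OF h])
  have "emeasure (mala_kernel n (target n) h x) {y \<in> space (lborel_Rn n). y 0 \<in> S}
    \<le> (\<integral>\<^sup>+y. ennreal (langevin n h x y) * indicator {y \<in> space (lborel_Rn n). y 0 \<in> S} y \<partial>lborel_Rn n)"
    unfolding mala_eq_mh_kernel[OF h]
    by (rule mh_kernel_le_proposal[OF x _ sets_cylinder[OF n S(1)]]) (use S(2) in simp)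
  also have "\<dots> = (\<integral>\<^sup>+t. ennreal (normal_density (x 0 + h * score (x 0)) (sqrt (2 * h)) t)
      * indicator S t \<partial>lborel)"
    unfolding langevin_def using n h
    by (intro nn_integral_prod_cylinder[where k=0
        and f="\<lambda>i. normal_density (x i + h * score (x i)) (sqrt (2 * h))"])
      (auto intro: nn_integral_normal_density)
  finally show ?thesis .
qed

text \<open>The small set contains two points \<open>x\<close>, \<open>y\<close> whose first coordinates are at least \<open>1/(4B)\<close>
  apart. A step of size \<open>h\<close> with \<open>h M \<le> 1/2\<close> at most halves this gap, so the two proposals have first
  coordinates with means at distance at least \<open>2r\<close> for \<open>r = 1/(16B)\<close>, and every real number is at
  distance at least \<open>r\<close> from one of the means. Hence the space is a union of two sets, one of small
  mass under \<open>P(x, \<cdot>)\<close> and one of small mass under \<open>P(y, \<cdot>)\<close>, apart from the atoms at \<open>x\<close> and \<open>y\<close>; but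
  \<open>P(y, \<cdot>)\<close> does not charge the hyperplane \<open>z\<^sub>0 = x\<^sub>0\<close>, nor \<open>P(x, \<cdot>)\<close> the hyperplane \<open>z\<^sub>0 = y\<^sub>0\<close>. A measure
  \<open>\<epsilon> \<nu>\<close> below both kernels must therefore be small.\<close>

lemma mala_minorization_tiny:
  assumes n: "n \<ge> 1" and h: "h > 0" "h * M \<le> 1/2"
    and T: "(\<eta>, L, \<epsilon>, d) \<in> T_tilde (Rn n) (mala_kernel n (target n) h)"
  shows "\<epsilon> \<le> 2 * sqrt 2 * exp (- (1 / (16 * B))\<^sup>2 / (8 * h))"
proof -
  interpret metropolis_hastings "lborel_Rn n" "target n" "langevin n h" by (rule langevin_mh[OF h(1)])
  let ?N = "lborel_Rn n" and ?P = "mala_kernel n (target n) h"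
  define \<mu> where "\<mu> = density ?N (\<lambda>x. ennreal (target n x))"
  have sN: "sets (Rn n) = sets ?N" by (rule sets_PiM_cong) auto
  have spN: "space (Rn n) = space ?N" by (rule sets_eq_imp_space_eq[OF sN])
  have pars: "0 \<le> \<eta>" "\<eta> < 1" "0 \<le> L" "0 < \<epsilon>" using T by (auto simp: T_tilde_def T0_def)
  obtain V \<nu> where V: "V \<in> borel_measurable ?N" "\<And>x. x \<in> space ?N \<Longrightarrow> 0 \<le> V x"
    and \<nu>: "\<nu> \<in> space (prob_algebra (Rn n))"
    and drift: "\<And>x. x \<in> space ?N \<Longrightarrow> (\<integral>\<^sup>+y. ennreal (V y) \<partial>?P x) \<le> ennreal (\<eta> * V x + L)"
    and d: "d > 0" "d > 2 * L / (1 - \<eta>)"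
    and minor: "\<And>x A. x \<in> space ?N \<Longrightarrow> V x \<le> d \<Longrightarrow> A \<in> sets ?N \<Longrightarrow> \<epsilon> * measure \<nu> A \<le> measure (?P x) A"
    using T unfolding T_tilde_def drift_minor_def spN sN measurable_cong_sets[OF sN refl] by auto
  have sP: "sets (?P x) = sets ?N" "emeasure (?P x) (space ?N) = 1" if "x \<in> space ?N" for x
    unfolding mala_eq_mh_kernel[OF h(1)]
    by (rule sets_mh_kernel[OF that], rule emeasure_mh_kernel_space[OF that])
  have sp\<mu>: "space \<mu> = space ?N" by (simp add: \<mu>_def)
  interpret \<mu>: prob_space \<mu>
  proof (rule prob_spaceI)
    have "emeasure \<mu> (space \<mu>) = (\<integral>\<^sup>+x. ennreal (target n x) * indicator (space ?N) x \<partial>?N)"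
      unfolding sp\<mu> unfolding \<mu>_def by (rule emeasure_density) auto
    also have "\<dots> = (\<integral>\<^sup>+x. ennreal (target n x) \<partial>?N)"
      by (rule nn_integral_cong) simp
    finally show "emeasure \<mu> (space \<mu>) = 1" by (simp add: target_prob)
  qed
  define C where "C = {x \<in> space ?N. V x \<le> d}"
  have C: "C \<in> sets ?N" unfolding C_def using V(1) by measurable
  have "measure \<mu> C > 1/2"
    unfolding C_def
  proof (rule drift_small_set_mass[where P="?P" and V=V and \<eta>=\<eta> and L=L])
    show "prob_space \<mu>" by (rule \<mu>.prob_space_axioms)
    show "(\<integral>\<^sup>+x. (\<integral>\<^sup>+y. \<phi> y \<partial>?P x) \<partial>\<mu>) = (\<integral>\<^sup>+x. \<phi> x \<partial>\<mu>)" if "\<phi> \<in> borel_measurable ?N" for \<phi>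
      unfolding mala_eq_mh_kernel[OF h(1)] \<mu>_def by (rule mh_stationary[OF that])
  qed (use V drift d pars sP in \<open>auto simp: \<mu>_def\<close>)
  then have "emeasure \<mu> C > ennreal (1/2)"
    unfolding \<mu>.emeasure_eq_measure by (intro ennreal_lessI) auto
  from small_set_spread[OF n C this[unfolded \<mu>_def]]
  obtain x y where x: "x \<in> C" and y: "y \<in> C" and xy: "1 / (4 * B) \<le> \<bar>x 0 - y 0\<bar>" by blast
  have xN: "x \<in> space ?N" "V x \<le> d" and yN: "y \<in> space ?N" "V y \<le> d" using x y by (auto simp: C_def)
  define r where "r = 1 / (16 * B)"
  have r: "r > 0" "4 * r = 1 / (4 * B)" using B_pos by (auto simp: r_def)
  define m where "m t = t + h * score t" for t
  have sep: "2 * r \<le> \<bar>m (x 0) - m (y 0)\<bar>"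
  proof -
    have "\<bar>score (x 0) - score (y 0)\<bar> \<le> M * \<bar>x 0 - y 0\<bar>"
      using score_Lipschitz[of "x 0" "y 0"] by (simp add: abs_minus_commute)
    then have "h * \<bar>score (x 0) - score (y 0)\<bar> \<le> h * (M * \<bar>x 0 - y 0\<bar>)"
      using h by (intro mult_left_mono) auto
    also have "\<dots> \<le> 1/2 * \<bar>x 0 - y 0\<bar>"
      using h(2) by (simp only: mult.assoc[symmetric]) (intro mult_right_mono, auto)
    finally have "\<bar>h * (score (x 0) - score (y 0))\<bar> \<le> 1/2 * \<bar>x 0 - y 0\<bar>"
      using h by (simp add: abs_mult)
    moreover have "\<bar>x 0 - y 0\<bar> \<le> \<bar>m (x 0) - m (y 0)\<bar> + \<bar>h * (score (x 0) - score (y 0))\<bar>"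
    proof -
      have "x 0 - y 0 = (m (x 0) - m (y 0)) - h * (score (x 0) - score (y 0))"
        by (simp add: m_def algebra_simps)
      then show ?thesis using abs_triangle_ineq4 by metis
    qed
    moreover have "4 * r \<le> \<bar>x 0 - y 0\<bar>" using xy unfolding r(2) .
    moreover have "2 * r \<le> w" if "v \<le> 1/2 * u" "u \<le> w + v" "4 * r \<le> u" for u v w :: real
      using that by linarith
    ultimately show ?thesis by blast
  qed
  define tail where "tail = sqrt 2 * exp (- r\<^sup>2 / (8 * h))"
  have tail_bound: "(\<integral>\<^sup>+t. ennreal (normal_density u (sqrt (2 * h)) t)
      * indicator {t. r \<le> \<bar>t - u\<bar>} t \<partial>lborel) \<le> ennreal tail" for u
    using normal_tail[of "sqrt (2 * h)" r u] h r by (simp add: tail_def)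
  \<comment> \<open>The two kernels are told apart by their first coordinates, so only cylinder events over
    the first coordinate matter.\<close>
  define cyl where "cyl S = {z \<in> space ?N. z 0 \<in> S}" for S :: "real set"
  have cyl: "cyl S \<in> sets ?N" if "S \<in> sets borel" for S
    unfolding cyl_def by (rule sets_cylinder[OF n that])
  have bound: "\<epsilon> * measure \<nu> (cyl S) \<le> b"
    if z: "z \<in> C" and S: "S \<in> sets borel" "z 0 \<notin> S" and b: "0 \<le> b"
      "(\<integral>\<^sup>+t. ennreal (normal_density (m (z 0)) (sqrt (2 * h)) t) * indicator S t \<partial>lborel)
          \<le> ennreal b" for z S b
  proof -
    have zN: "z \<in> space ?N" "V z \<le> d" using z by (auto simp: C_def)
    have "emeasure (?P z) (cyl S) \<le> ennreal b"
      using mala_cylinder_le[OF n h(1) zN(1) S] b(2) by (simp add: cyl_def m_def)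
    then have "measure (?P z) (cyl S) \<le> b"
      using b(1) by (simp add: measure_def enn2real_leI)
    with minor[OF zN cyl[OF S(1)]] show ?thesis by linarith
  qed
  have tail0: "0 \<le> tail" by (simp add: tail_def)
  have S[measurable]: "{t. r \<le> \<bar>t - u\<bar>} \<in> sets borel" for u :: real by measurable
  have far: "\<epsilon> * measure \<nu> (cyl ({t. r \<le> \<bar>t - m (z 0)\<bar>} - {z 0})) \<le> tail" if "z \<in> C" for z
  proof (rule bound[OF that])
    show "(\<integral>\<^sup>+t. ennreal (normal_density (m (z 0)) (sqrt (2 * h)) t)
        * indicator ({t. r \<le> \<bar>t - m (z 0)\<bar>} - {z 0}) t \<partial>lborel) \<le> ennreal tail"
      by (rule order_trans[OF nn_integral_mono tail_bound]) (auto simp: indicator_def)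
  qed (auto simp: tail0)
  \<comment> \<open>\<open>\<nu>\<close> inherits null hyperplanes from the kernel started at a point off the hyperplane.\<close>
  have point: "\<epsilon> * measure \<nu> (cyl {w}) \<le> 0" if "z \<in> C" "z 0 \<noteq> w" for z w
  proof (rule bound[OF that(1)])
    have "AE t in lborel. t \<noteq> w" by (rule AE_lborel_singleton)
    then have "(\<integral>\<^sup>+t. ennreal (normal_density (m (z 0)) (sqrt (2 * h)) t) * indicator {w} t \<partial>lborel)
        = (\<integral>\<^sup>+t. 0 \<partial>(lborel :: real measure))"
      by (intro nn_integral_cong_AE) (auto elim: eventually_mono)
    then show "(\<integral>\<^sup>+t. ennreal (normal_density (m (z 0)) (sqrt (2 * h)) t) * indicator {w} t \<partial>lborel)
        \<le> ennreal 0"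
      by simp
  qed (use that in auto)
  interpret \<nu>: prob_space \<nu> using \<nu> by (simp add: space_prob_algebra)
  have s\<nu>: "sets \<nu> = sets ?N" using \<nu> sN by (simp add: space_prob_algebra)
  let ?X = "cyl ({t. r \<le> \<bar>t - m (x 0)\<bar>} - {x 0})" and ?Y = "cyl ({t. r \<le> \<bar>t - m (y 0)\<bar>} - {y 0})"
  have meas: "?X \<in> sets \<nu>" "?Y \<in> sets \<nu>" "cyl {x 0} \<in> sets \<nu>" "cyl {y 0} \<in> sets \<nu>"
    unfolding s\<nu> by (auto intro!: cyl)
  have cover: "space \<nu> \<subseteq> (?X \<union> ?Y) \<union> (cyl {x 0} \<union> cyl {y 0})"
  proof
    fix z assume "z \<in> space \<nu>"
    then have z: "z \<in> space ?N" using sets_eq_imp_space_eq[OF s\<nu>] by simp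
    have "r \<le> \<bar>z 0 - m (x 0)\<bar> \<or> r \<le> \<bar>z 0 - m (y 0)\<bar>" using sep by linarith
    then show "z \<in> (?X \<union> ?Y) \<union> (cyl {x 0} \<union> cyl {y 0})" using z by (auto simp: cyl_def)
  qed
  have "1 = measure \<nu> (space \<nu>)" by (rule \<nu>.prob_space[symmetric])
  also have "\<dots> \<le> measure \<nu> ((?X \<union> ?Y) \<union> (cyl {x 0} \<union> cyl {y 0}))"
    by (rule \<nu>.finite_measure_mono[OF cover]) (use meas in auto)
  also have "\<dots> \<le> (measure \<nu> ?X + measure \<nu> ?Y) + (measure \<nu> (cyl {x 0}) + measure \<nu> (cyl {y 0}))"
    using meas by (intro order_trans[OF measure_Un_le] add_mono measure_Un_le) auto
  finally have "\<epsilon> * 1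
      \<le> \<epsilon> * ((measure \<nu> ?X + measure \<nu> ?Y) + (measure \<nu> (cyl {x 0}) + measure \<nu> (cyl {y 0})))"
    using pars by (intro mult_left_mono) auto
  also have "\<dots> \<le> (tail + tail) + (0 + 0)"
    unfolding distrib_left using xy B_pos
    by (intro add_mono far x y point[OF y] point[OF x]) auto
  finally show ?thesis by (simp add: tail_def r_def)
qed

end

section \<open>The rate bound degenerates\<close>

theorem proposition22:
  fixes g :: "real \<Rightarrow> real" and M \<gamma> \<gamma>' :: real and h :: "nat \<Rightarrow> real"
    and \<SS> :: "'u measure set" and \<iota> :: "int \<Rightarrow> 'u"
  assumes "inj \<iota>"
    and "\<And>F. finite F \<Longrightarrow> \<exists>X\<in>\<SS>. sets X = sets (count_space (\<iota> ` F))"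
    and "\<And>x. g x > 0"
    and "\<And>x. g differentiable (at x)"
    and "(\<integral>\<^sup>+x. ennreal (g x) \<partial>lborel) = 1"
    and "bdd_above (range g)"
    and "\<And>x y. \<bar>- deriv (\<lambda>t. ln (g t)) x + deriv (\<lambda>t. ln (g t)) y\<bar> \<le> M * \<bar>x - y\<bar>"
    and "\<And>n. n \<ge> 1 \<Longrightarrow> h n > 0"
    and "\<gamma> > 0"
    and "\<And>n. n \<ge> 1 \<Longrightarrow> h n < real n powr (- \<gamma>)"
    and "\<gamma>' > 0"
  shows "(\<lambda>n. real n powr \<gamma>' *
            (1 - rho_dagger \<SS> (Rn n) (mala_kernel n (\<lambda>x. \<Prod>i<n. g (x i)) (h n))))
         \<longlonglongrightarrow> 0"
proof -
  obtain B where B: "\<And>x. g x \<le> B" using assms(6) by (auto simp: bdd_above_def)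
  interpret product_target g M B
    by unfold_locales (fact assms(3-5,7) B)+
  define c where "c = (1 / (16 * B))\<^sup>2 / 8"
  have c: "c > 0" using B_pos by (simp add: c_def)
  define P where "P n = mala_kernel n (target n) (h n)" for n
  have P: "mala_kernel n (\<lambda>x. \<Prod>i<n. g (x i)) (h n) = P n" for n
    unfolding P_def target_def[abs_def] by (rule refl)
  \<comment> \<open>Eventually \<open>h n * M \<le> 1/2\<close>, as separating the proposals requires.\<close>
  have "((\<lambda>n. real n powr (- \<gamma>) * M) \<longlongrightarrow> 0) sequentially"
    using assms(9) by real_asymp
  then have "\<forall>\<^sub>F n in sequentially. real n powr (- \<gamma>) * M < 1/2"
    by (rule order_tendstoD) simp
  then have bounds: "\<forall>\<^sub>F n in sequentially. 0 \<le> 1 - rho_dagger \<SS> (Rn n) (P n)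
      \<and> 1 - rho_dagger \<SS> (Rn n) (P n) \<le> 2 * sqrt 2 * exp (- c * real n powr \<gamma>)"
    using eventually_ge_at_top[of 1]
  proof eventually_elim
    case (elim n)
    have hn: "h n > 0" "h n < real n powr (- \<gamma>)" using assms(8,10) elim by auto
    have "h n * M \<le> real n powr (- \<gamma>) * M" using hn M_nonneg by (intro mult_right_mono) auto
    with elim have hM: "h n * M \<le> 1/2" by linarith
    have "real n powr \<gamma> \<le> 1 / h n"
      using hn elim by (simp add: powr_minus field_simps)
    then have "c * real n powr \<gamma> \<le> c * (1 / h n)" using c by (intro mult_left_mono) auto
    then have exp_le: "2 * sqrt 2 * exp (- c / h n) \<le> 2 * sqrt 2 * exp (- c * real n powr \<gamma>)" by simp
    have lower: "1 - 2 * sqrt 2 * exp (- c / h n) \<le> rho_opt \<SS> \<theta>" if "\<theta> \<in> T_tilde (Rn n) (P n)" for \<theta>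
    proof -
      obtain \<eta> L \<epsilon> d where \<theta>: "\<theta> = (\<eta>, L, \<epsilon>, d)" by (cases \<theta>)
      have "\<epsilon> \<le> 2 * sqrt 2 * exp (- (1 / (16 * B))\<^sup>2 / (8 * h n))"
        using that unfolding \<theta> P_def by (rule mala_minorization_tiny[OF elim(2) hn(1) hM])
      also have "- (1 / (16 * B))\<^sup>2 / (8 * h n) = - c / h n" by (simp add: c_def)
      finally have "\<epsilon> \<le> 2 * sqrt 2 * exp (- c / h n)" .
      moreover have "1 - \<epsilon> \<le> rho_opt \<SS> \<theta>"
        unfolding \<theta> by (rule rho_opt_ge_one_minus_eps[OF assms(1,2)])
          (use that in \<open>auto simp: \<theta> T_tilde_def T0_def drift_minor_def\<close>)
      ultimately show ?thesis by linarith
    qed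
    have "1 - 2 * sqrt 2 * exp (- c / h n) \<le> rho_dagger \<SS> (Rn n) (P n)"
      unfolding rho_dagger_def using lower by (auto intro!: cINF_greatest)
    moreover have "rho_dagger \<SS> (Rn n) (P n) \<le> 1"
    proof (cases "T_tilde (Rn n) (P n) = {}")
      case False
      then obtain \<theta> where \<theta>: "\<theta> \<in> T_tilde (Rn n) (P n)" by blast
      have "bdd_below (rho_opt \<SS> ` T_tilde (Rn n) (P n))" using lower by (rule bdd_belowI2)
      from cINF_lower2[OF this \<theta> rho_opt_le_1] False show ?thesis by (simp add: rho_dagger_def)
    qed (simp add: rho_dagger_def)
    ultimately show ?case using exp_le by (intro conjI) linarith+
  qed
  have "(\<lambda>n. real n powr \<gamma>' * (2 * sqrt 2 * exp (- c * real n powr \<gamma>))) \<longlonglongrightarrow> 0"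
    using assms(9,11) c by real_asymp
  then show ?thesis
    unfolding P
    by (rule tendsto_sandwich[OF _ _ tendsto_const, rotated 2])
      (use bounds in \<open>auto elim!: eventually_mono intro: mult_left_mono\<close>)
qed

end
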